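(* Let $\Gamma\subset\mathbb{R}$ be a countable dense additive subgroup and let $\mathcal{H}:=\mathbb{R}_\Gamma\rtimes\Gamma$ be the transformation groupoid of the translation action. When $\operatorname{rank}\Gamma=2$, the action $\Gamma\curvearrowright\mathbb{R}_\Gamma$ is $H^1$-rigid. In other words, the natural homomorphism $\mathcal{H}\to\Gamma$ induces an isomorphism between $H^1(\mathcal{H})$ and $H^1(\Gamma)=\operatorname{Hom}(\Gamma,\mathbb{Z})$.
   Context: $\operatorname{rank}\Gamma:=\dim_{\mathbb{Q}}(\Gamma\otimes\mathbb{Q})$. The space $\mathbb{R}_\Gamma$: as a set $\mathbb{R}_\Gamma=(\mathbb{R}\setminus\Gamma)\sqcup\{t_+,t_-\mid t\in\Gamma\}$, with the canonical surjection $q:\mathbb{R}_\Gamma\to\mathbb{R}$ ($q(t_\pm)=t$, $q(x)=x$ for $x\notin\Gamma$), the total order such that $q(x)<q(y)$ implies $x<y$ and $t_-<t_+$ for $t\in\Gamma$, and the order topology. It is totally disconnected and locally compact Hausdorff; the sets $[t_+,s_-]$ ($t<s$ in $\Gamma$) are compact open and form a basis. $\Gamma$ acts on $\mathbb{R}_\Gamma$ by translation: $s\cdot x=x+s$ for $x\in\mathbb{R}\setminus\Gamma$, $s\cdot t_\pm=(t+s)_\pm$. For an action of a discrete group $G$ on $X$, the transformation groupoid $X\rtimes G$ is $X\times G$ with the product topology, unit space $X$ (identified with $X\times\{1\}$), $r(x,\gamma)=x$, $s(x,\gamma)=\gamma^{-1}x$, $(x,\gamma)(\gamma^{-1}x,\gamma')=(x,\gamma\gamma')$;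 the natural homomorphism $\pi:X\rtimes G\to G$ is $\pi(x,\gamma)=\gamma$. For an ample groupoid $\mathcal{G}$, $H^1(\mathcal{G})=H^1(\mathcal{G},\mathbb{Z})$ is the group of continuous homomorphisms $\xi:\mathcal{G}\to\mathbb{Z}$ modulo coboundaries, i.e. homomorphisms of the form $g\mapsto f(r(g))-f(s(g))$ with $f:\mathcal{G}^{(0)}\to\mathbb{Z}$ continuous. A homomorphism $\pi$ induces $H^1(\pi):[\xi]\mapsto[\xi\circ\pi]$. An action $G\curvearrowright X$ is $H^1$-rigid if $H^1(\pi):\operatorname{Hom}(G,\mathbb{Z})=H^1(G)\to H^1(X\rtimes G)$ is an isomorphism. *)

theory Defs
  imports
    "HOL-Analysis.Analysis"
    "HOL-Algebra.Elementary_Groups"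
    "HOL-Algebra.Free_Abelian_Groups"
    "HOL-Algebra.Generated_Groups"
    "HOL-Library.Extended_Nat"
    "Jordan_Normal_Form.Missing_VectorSpace"
begin

section \<open>The rank of an abelian group\<close>

text \<open>
  The group \<open>G \<otimes>\<^sub>\<int> \<rat>\<close> is the free abelian group on the symbols \<open>(a, p)\<close>, standing for
  \<open>a \<otimes> p\<close>, modulo the subgroup generated by the biadditivity relations.
\<close>

definition tensor_rat_free :: "('a, 'm) monoid_scheme \<Rightarrow> ('a \<times> rat \<Rightarrow>\<^sub>0 int) monoid" where
  "tensor_rat_free G = free_Abelian_group (carrier G \<times> UNIV)"

definition tensor_rat_relations :: "('a, 'm) monoid_scheme \<Rightarrow> ('a \<times> rat \<Rightarrow>\<^sub>0 int) set" where
  "tensor_rat_relations G = generate (tensor_rat_free G)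
     ({frag_of (a \<otimes>\<^bsub>G\<^esub> b, p) - frag_of (a, p) - frag_of (b, p) | a b p.
         a \<in> carrier G \<and> b \<in> carrier G} \<union>
      {frag_of (a, p + p') - frag_of (a, p) - frag_of (a, p') | a p p'. a \<in> carrier G})"

text \<open>
  The rational vector space structure is determined by \<open>q \<odot> (a \<otimes> p) = a \<otimes> (q * p)\<close>.
  The fields \<open>mult\<close> and \<open>one\<close> are inherited by module records from ring records but play no
  role in modules.
\<close>

definition tensor_rat ::
    "('a, 'm) monoid_scheme \<Rightarrow> (rat, ('a \<times> rat \<Rightarrow>\<^sub>0 int) set) module" where
  "tensor_rat G =
     (let F = tensor_rat_free G; R = tensor_rat_relations G in
      \<lparr>carrier = carrier (F Mod R), mult = undefined, one = undefined,
       zero = \<one>\<^bsub>F Mod R\<^esub>, add = (\<otimes>\<^bsub>F Mod R\<^esub>),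
       smult = (\<lambda>q C. \<Union>c\<in>C. R #>\<^bsub>F\<^esub> frag_extend (\<lambda>(a, p). frag_of (a, q * p)) c)\<rparr>)"

definition rat_field :: "rat ring" where
  "rat_field = \<lparr>carrier = UNIV, mult = (*), one = 1, zero = 0, add = (+)\<rparr>"

text \<open>
  \<^const>\<open>vectorspace.dim\<close> is unspecified for infinite-dimensional spaces, hence the case
  distinction.
\<close>

definition group_rank :: "('a, 'm) monoid_scheme \<Rightarrow> enat" where
  "group_rank G =
     (if vectorspace.fin_dim rat_field (tensor_rat G)
      then enat (vectorspace.dim rat_field (tensor_rat G)) else \<infinity>)"


section \<open>First cohomology of topological groupoids\<close>

text \<open>
  \<open>gprod g h\<close> is meaningful only if \<open>gsource g = grange h\<close>. The unit space is kept as a separate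
  space, and the inverse is not recorded since it is determined by the product.
\<close>

record ('u, 'g) top_groupoid =
  units :: "'u topology"
  arrows :: "'g topology"
  grange :: "'g \<Rightarrow> 'u"
  gsource :: "'g \<Rightarrow> 'u"
  gprod :: "'g \<Rightarrow> 'g \<Rightarrow> 'g"

definition group_groupoid :: "('g, 'm) monoid_scheme \<Rightarrow> (unit, 'g) top_groupoid" where
  "group_groupoid G =
     \<lparr>units = discrete_topology UNIV, arrows = discrete_topology (carrier G),
      grange = (\<lambda>_. ()), gsource = (\<lambda>_. ()), gprod = (\<otimes>\<^bsub>G\<^esub>)\<rparr>"

definition transformation_groupoid ::
    "'x topology \<Rightarrow> ('g, 'm) monoid_scheme \<Rightarrow> ('g \<Rightarrow> 'x \<Rightarrow> 'x) \<Rightarrow> ('x, 'x \<times> 'g) top_groupoid" where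
  "transformation_groupoid X G act =
     \<lparr>units = X, arrows = prod_topology X (discrete_topology (carrier G)),
      grange = fst, gsource = (\<lambda>(x, \<gamma>). act (inv\<^bsub>G\<^esub> \<gamma>) x),
      gprod = (\<lambda>(x, \<gamma>) (_, \<gamma>'). (x, \<gamma> \<otimes>\<^bsub>G\<^esub> \<gamma>'))\<rparr>"

text \<open>
  Homomorphisms are extensional functions (\<open>undefined\<close> off the arrows), so that equality of
  functions is equality on the arrows.
\<close>

definition Z1 :: "('u, 'g) top_groupoid \<Rightarrow> ('g \<Rightarrow> int) monoid" where
  "Z1 \<G> =
     \<lparr>carrier = {\<xi> \<in> extensional (topspace (arrows \<G>)).
        continuous_map (arrows \<G>) (discrete_topology UNIV) \<xi> \<and>
        (\<forall>g \<in> topspace (arrows \<G>). \<forall>h \<in> topspace (arrows \<G>).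
           gsource \<G> g = grange \<G> h \<longrightarrow> \<xi> (gprod \<G> g h) = \<xi> g + \<xi> h)},
      mult = (\<lambda>\<xi> \<eta>. \<lambda>g \<in> topspace (arrows \<G>). \<xi> g + \<eta> g),
      one = (\<lambda>g \<in> topspace (arrows \<G>). 0)\<rparr>"

definition B1 :: "('u, 'g) top_groupoid \<Rightarrow> ('g \<Rightarrow> int) set" where
  "B1 \<G> = {\<lambda>g \<in> topspace (arrows \<G>). f (grange \<G> g) - f (gsource \<G> g) | f.
             continuous_map (units \<G>) (discrete_topology UNIV) f}"

definition H1 :: "('u, 'g) top_groupoid \<Rightarrow> ('g \<Rightarrow> int) set monoid" where
  "H1 \<G> = Z1 \<G> Mod B1 \<G>"

definition pullback_class ::
    "('u, 'g) top_groupoid \<Rightarrow> ('g \<Rightarrow> 'h) \<Rightarrow> ('h \<Rightarrow> int) \<Rightarrow> ('g \<Rightarrow> int) set" where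
  "pullback_class \<G> \<pi> \<xi> = B1 \<G> #>\<^bsub>Z1 \<G>\<^esub> restrict (\<xi> \<circ> \<pi>) (topspace (arrows \<G>))"

text \<open>
  The map on \<^const>\<open>H1\<close> induced by a homomorphism \<open>\<pi>\<close> out of \<open>\<G>\<close>. For a class \<open>C\<close> the set
  \<open>pullback_class \<G> \<pi> ` C\<close> is a singleton.
\<close>

definition H1_map ::
    "('u, 'g) top_groupoid \<Rightarrow> ('g \<Rightarrow> 'h) \<Rightarrow> ('h \<Rightarrow> int) set \<Rightarrow> ('g \<Rightarrow> int) set" where
  "H1_map \<G> \<pi> C = the_elem (pullback_class \<G> \<pi> ` C)"

definition H1_rigid ::
    "'x topology \<Rightarrow> ('g, 'm) monoid_scheme \<Rightarrow> ('g \<Rightarrow> 'x \<Rightarrow> 'x) \<Rightarrow> bool" where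
  "H1_rigid X G act \<longleftrightarrow>
     H1_map (transformation_groupoid X G act) snd
       \<in> iso (H1 (group_groupoid G)) (H1 (transformation_groupoid X G act))"

definition Hom_int :: "('g, 'm) monoid_scheme \<Rightarrow> ('g \<Rightarrow> int) monoid" where
  "Hom_int G =
     \<lparr>carrier = hom G integer_group \<inter> extensional (carrier G),
      mult = (\<lambda>\<phi> \<psi>. \<lambda>g \<in> carrier G. \<phi> g + \<psi> g),
      one = (\<lambda>g \<in> carrier G. 0)\<rparr>"


section \<open>The line with the points of a subgroup doubled\<close>

definition real_add_group :: "real monoid" where
  "real_add_group = \<lparr>carrier = UNIV, mult = (+), one = 0\<rparr>"

text \<open>\<open>Lower t\<close> and \<open>Upper t\<close> stand for \<open>t\<^sub>-\<close> and \<open>t\<^sub>+\<close>.\<close>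

datatype split_point = Single real | Lower real | Upper real

definition split_line :: "real set \<Rightarrow> split_point set" where
  "split_line \<Gamma> = Single ` (- \<Gamma>) \<union> Lower ` \<Gamma> \<union> Upper ` \<Gamma>"

fun split_proj :: "split_point \<Rightarrow> real" where
  "split_proj (Single x) = x"
| "split_proj (Lower t) = t"
| "split_proj (Upper t) = t"

definition split_less :: "split_point \<Rightarrow> split_point \<Rightarrow> bool" where
  "split_less x y \<longleftrightarrow>
     split_proj x < split_proj y \<or> (\<exists>t. x = Lower t \<and> y = Upper t)"

definition split_topology :: "real set \<Rightarrow> split_point topology" where
  "split_topology \<Gamma> = topology_generated_by
     (insert (split_line \<Gamma>)
       ((\<lambda>a. {x \<in> split_line \<Gamma>. split_less a x}) ` split_line \<Gamma> \<union>
        (\<lambda>a. {x \<in> split_line \<Gamma>. split_less x a}) ` split_line \<Gamma>))"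

fun split_translate :: "real \<Rightarrow> split_point \<Rightarrow> split_point" where
  "split_translate s (Single x) = Single (x + s)"
| "split_translate s (Lower t) = Lower (t + s)"
| "split_translate s (Upper t) = Upper (t + s)"

end

theory Submission
  imports Defs
begin

text \<open>
  Write \<open>X\<close> for the split line. A continuous function \<open>f : X \<rightarrow> \<int>\<close> is locally constant, so it is
  determined up to a constant by its jumps \<open>j(t) = f(t\<^sub>+) - f(t\<^sub>-)\<close> at the points \<open>t \<in> \<Gamma>\<close>. The jumps form
  a locally finite function on \<open>\<Gamma>\<close> (\<open>locally_finite_jump\<close>, \<open>constant_if_no_jumps\<close>), and every locally
  finite function on \<open>\<Gamma>\<close> occurs (\<open>continuous_step_function\<close>, \<open>jump_step_function\<close>).

  A homomorphism from the transformation groupoid to \<open>\<int>\<close> is a family of continuous functions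
  \<open>c\<^sub>\<gamma>\<close> with \<open>c\<^sub>\<gamma>\<^sub>+\<^sub>\<delta>(x) = c\<^sub>\<gamma>(x) + c\<^sub>\<delta>(x - \<gamma>)\<close>, and its jumps \<open>J\<^sub>\<gamma>\<close> satisfy the same identity. Suppose that
  \<open>J\<^sub>\<gamma>(t) = k(t) - k(t - \<gamma>)\<close> for one locally finite \<open>k\<close>. Let \<open>h\<close> be a continuous function with jumps \<open>k\<close>.
  Then \<open>c\<^sub>\<gamma>(x) - h(x) + h(x - \<gamma>)\<close> has no jumps, so it is a constant \<open>\<phi>(\<gamma>)\<close>, and \<open>c\<close> is cohomologous to the
  homomorphism \<open>\<phi>\<close>. This gives surjectivity. The existence of \<open>k\<close> is the heart of the matter.

  If all elements of \<open>\<Gamma>\<close> were rational multiples of one \<open>b \<in> \<Gamma>\<close>, the space \<open>\<Gamma> \<otimes> \<rat>\<close> would be spanned by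
  \<open>b \<otimes> 1\<close>. So rank two provides \<open>a, b \<in> \<Gamma>\<close> with \<open>b > 0\<close> and \<open>a / b\<close> irrational
  (\<open>exists_incommensurable\<close>). In the direction of \<open>b\<close> alone the equation \<open>k(t) - k(t - b) = J\<^sub>b(t)\<close> can be
  solved by summation starting at the origin (\<open>locally_finite_primitive\<close>), so \<open>J\<^sub>b = 0\<close> may be assumed.
  Then the cocycle identity for \<open>b + \<gamma> = \<gamma> + b\<close> makes each \<open>J\<^sub>\<gamma>\<close> periodic with period \<open>b\<close>: it is a finitely
  supported function on the circle \<open>\<real> / b\<int>\<close>, on which translation by \<open>a\<close> is an irrational rotation. A
  finitely supported \<open>k\<close> with \<open>k(t) - k(t - a) = J\<^sub>a(t)\<close> exists as soon as the sum of \<open>J\<^sub>a\<close> over each orbit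
  of this rotation, called its charge here, vanishes (\<open>periodic_primitive\<close>). From
  \<open>J\<^sub>a(t) - J\<^sub>a(t - \<gamma>) = J\<^sub>\<gamma>(t) - J\<^sub>\<gamma>(t - a)\<close> the charge is the same on all orbits in \<open>\<Gamma>\<close>
  (\<open>charge_translate_eq\<close>). On the other hand \<open>J\<^sub>a\<close> has total sum zero over a period, because it consists of
  the jumps of the periodic function \<open>c\<^sub>a\<close>; this total is the common charge times the number of orbits that
  meet the support, so the charge is zero (\<open>charge_eq_0\<close>). For the other \<open>\<gamma>\<close> the function
  \<open>J\<^sub>\<gamma>(t) - k(t) + k(t - \<gamma>)\<close> is locally finite and invariant under \<open>a\<close> and \<open>b\<close>; as the orbits of the
  rotation are infinite, it vanishes (\<open>jump_cocycle_is_coboundary\<close>).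

  The last observation also gives injectivity: if \<open>\<phi>(\<gamma>) = f(x) - f(x - \<gamma>)\<close>, then the jumps of \<open>f\<close> are
  invariant under \<open>\<Gamma>\<close>, so \<open>f\<close> has none and is constant, and \<open>\<phi> = 0\<close>.
\<close>

section \<open>The rational rank\<close>

lemma field_rat_field: "field rat_field"
proof -
  have *: "\<exists>y. x * y = 1" if "x \<noteq> 0" for x :: rat
    using that by (intro exI[of _ "1 / x"]) simp
  have "cring rat_field"
    by (rule cringI; (rule abelian_groupI comm_monoidI)?)
       (auto simp: rat_field_def algebra_simps intro: exI[of _ "- _"])
  then show ?thesis
    by (rule cring.cring_fieldI2) (auto simp: rat_field_def * mult.commute)
qed

lemma (in vectorspace) dim_le_1_if_all_multiples:
  assumes v: "v \<in> carrier V"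
    and multiples: "\<And>x. x \<in> carrier V \<Longrightarrow> \<exists>q\<in>carrier K. x = q \<odot>\<^bsub>V\<^esub> v"
  shows "dim \<le> 1"
proof (rule dim_le1I[OF _ v])
  have "x \<in> span {v}" if x: "x \<in> carrier V" for x
  proof -
    from multiples[OF x] obtain q where q: "q \<in> carrier K" "x = q \<odot>\<^bsub>V\<^esub> v" by blast
    have "lincomb (\<lambda>_. q) {v} = x"
      unfolding lincomb_def using v q by simp
    then show ?thesis using q unfolding span_def by blast
  qed
  then show "gen_set {v}" using span_is_subset2[of "{v}"] v by blast
qed

lemmas formal_sum_induct = free_Abelian_group_induct[consumes 1, case_names zero diff of]

context comm_group begin

lemma tensor_rat_free_simps [simp]:
  "x \<in> carrier (tensor_rat_free G) \<longleftrightarrow> Poly_Mapping.keys x \<subseteq> carrier G \<times> UNIV"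
  "\<one>\<^bsub>tensor_rat_free G\<^esub> = 0"
  "x \<otimes>\<^bsub>tensor_rat_free G\<^esub> y = x + y"
  by (auto simp: tensor_rat_free_def)

lemma comm_group_tensor_rat_free: "comm_group (tensor_rat_free G)"
  unfolding tensor_rat_free_def by (rule abelian_free_Abelian_group)

lemma subgroup_tensor_rat_relations: "subgroup (tensor_rat_relations G) (tensor_rat_free G)"
  unfolding tensor_rat_relations_def
proof (rule group.generate_is_subgroup)
  show "group (tensor_rat_free G)"
    using comm_group_tensor_rat_free by (rule comm_group.axioms(2))
  show "{frag_of (a \<otimes> b, p) - frag_of (a, p) - frag_of (b, p) |a b p. a \<in> carrier G \<and> b \<in> carrier G} \<union>
    {frag_of (a, p + p') - frag_of (a, p) - frag_of (a, p') |a p p'. a \<in> carrier G}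
    \<subseteq> carrier (tensor_rat_free G)"
    by (auto dest!: subsetD[OF keys_diff] split: if_splits)
qed

lemma tensor_rat_relations_subset:
  "x \<in> tensor_rat_relations G \<Longrightarrow> Poly_Mapping.keys x \<subseteq> carrier G \<times> UNIV"
  using subsetD[OF subgroup.subset[OF subgroup_tensor_rat_relations], of x] by simp

lemma tensor_rat_relations_zero: "0 \<in> tensor_rat_relations G"
  using subgroup.one_closed[OF subgroup_tensor_rat_relations] by simp

lemma tensor_rat_relations_add:
  "x \<in> tensor_rat_relations G \<Longrightarrow> y \<in> tensor_rat_relations G \<Longrightarrow> x + y \<in> tensor_rat_relations G"
  using subgroup.m_closed[OF subgroup_tensor_rat_relations] by simp

lemma tensor_rat_relations_minus:
  "x \<in> tensor_rat_relations G \<Longrightarrow> - x \<in> tensor_rat_relations G"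
  using subgroup.m_inv_closed[OF subgroup_tensor_rat_relations, of x] tensor_rat_relations_subset[of x]
  by (simp add: tensor_rat_free_def)

lemma tensor_rat_relations_diff:
  "x \<in> tensor_rat_relations G \<Longrightarrow> y \<in> tensor_rat_relations G \<Longrightarrow> x - y \<in> tensor_rat_relations G"
  using tensor_rat_relations_add[of x "- y"] tensor_rat_relations_minus by simp

lemma tensor_rat_relations_left:
  assumes "a \<in> carrier G" "b \<in> carrier G"
  shows "frag_of (a \<otimes> b, p) - frag_of (a, p) - frag_of (b, p) \<in> tensor_rat_relations G"
  unfolding tensor_rat_relations_def by (rule generate.incl) (use assms in blast)

lemma tensor_rat_relations_right:
  assumes "a \<in> carrier G"
  shows "frag_of (a, p + p') - frag_of (a, p) - frag_of (a, p') \<in> tensor_rat_relations G"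
  unfolding tensor_rat_relations_def by (rule generate.incl) (use assms in blast)

end

text \<open>Multiplication by the scalar \<open>q\<close>, lifted from \<open>\<Gamma> \<otimes> \<rat>\<close> to formal sums of symbols \<open>a \<otimes> p\<close>.\<close>
definition tensor_scale :: "rat \<Rightarrow> ('a \<times> rat \<Rightarrow>\<^sub>0 int) \<Rightarrow> ('a \<times> rat \<Rightarrow>\<^sub>0 int)" where
  "tensor_scale q = frag_extend (\<lambda>(a, p). frag_of (a, q * p))"

lemma tensor_scale_simps [simp]:
  "tensor_scale q 0 = 0"
  "tensor_scale q (frag_of (a, p)) = frag_of (a, q * p)"
  "tensor_scale q (x - y) = tensor_scale q x - tensor_scale q y"
  "tensor_scale q (x + y) = tensor_scale q x + tensor_scale q y"
  "tensor_scale q (- x) = - tensor_scale q x"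
  by (simp_all add: tensor_scale_def frag_extend_diff frag_extend_add frag_extend_minus)

lemma tensor_scale_keys:
  assumes "Poly_Mapping.keys x \<subseteq> S \<times> UNIV"
  shows "Poly_Mapping.keys (tensor_scale q x) \<subseteq> S \<times> UNIV"
  using assms
proof (induction x rule: formal_sum_induct)
  case (diff x y)
  then show ?case using keys_diff[of "tensor_scale q x" "tensor_scale q y"] by auto
qed auto

lemma tensor_scale_scale:
  "tensor_scale p (tensor_scale q x) = tensor_scale (p * q) x"
  using subset_UNIV
proof (induction x rule: formal_sum_induct)
  case (of a)
  then show ?case by (cases a rule: prod.exhaust) (simp add: mult.assoc)
qed auto

lemma tensor_scale_one: "tensor_scale 1 x = x"
  using subset_UNIV
proof (induction x rule: formal_sum_induct)
  case (of a)
  then show ?case by (cases a rule: prod.exhaust) simp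
qed auto

context comm_group begin

text \<open>
  Multiplying a biadditivity relation by a scalar gives another biadditivity relation, so scalar
  multiplication descends to the quotient.
\<close>
lemma tensor_scale_relations:
  assumes "x \<in> tensor_rat_relations G"
  shows "tensor_scale q x \<in> tensor_rat_relations G"
  using assms unfolding tensor_rat_relations_def[of G]
proof (induction x rule: generate.induct)
  case one
  then show ?case using tensor_rat_relations_zero by (simp add: tensor_rat_relations_def)
next
  case (incl h)
  then show ?case
    unfolding tensor_rat_relations_def[symmetric]
    by (auto simp: distrib_left intro: tensor_rat_relations_left tensor_rat_relations_right)
next
  case (inv h)
  then have h: "h \<in> tensor_rat_relations G" unfolding tensor_rat_relations_def by (rule generate.incl)
  from inv have "tensor_scale q h \<in> tensor_rat_relations G"
    by (auto simp: distrib_left intro: tensor_rat_relations_left tensor_rat_relations_right)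
  then show ?case
    unfolding tensor_rat_relations_def[symmetric]
    using tensor_rat_relations_minus[of "tensor_scale q h"] tensor_rat_relations_subset[OF h]
    by (simp add: tensor_rat_free_def)
next
  case (eng h1 h2)
  then show ?case
    unfolding tensor_rat_relations_def[symmetric]
    using tensor_rat_relations_add by simp
qed

text \<open>The element of \<open>G \<otimes> \<rat>\<close> that a formal sum represents.\<close>
definition tensor_class :: "('a \<times> rat \<Rightarrow>\<^sub>0 int) \<Rightarrow> ('a \<times> rat \<Rightarrow>\<^sub>0 int) set" where
  "tensor_class x = tensor_rat_relations G #>\<^bsub>tensor_rat_free G\<^esub> x"

lemma mem_tensor_class: "y \<in> tensor_class x \<longleftrightarrow> y - x \<in> tensor_rat_relations G"
proof -
  have "y \<in> tensor_class x \<longleftrightarrow> (\<exists>h\<in>tensor_rat_relations G. y = h + x)"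
    by (simp add: tensor_class_def r_coset_def)
  also have "\<dots> \<longleftrightarrow> (\<exists>h\<in>tensor_rat_relations G. y - x = h)"
    by (simp add: diff_eq_eq)
  finally show ?thesis by simp
qed

lemma tensor_class_eq_iff: "tensor_class x = tensor_class y \<longleftrightarrow> x - y \<in> tensor_rat_relations G"
proof
  assume "tensor_class x = tensor_class y"
  then have "x \<in> tensor_class y" using mem_tensor_class[of x x] tensor_rat_relations_zero by simp
  then show "x - y \<in> tensor_rat_relations G" by (simp add: mem_tensor_class)
next
  assume *: "x - y \<in> tensor_rat_relations G"
  show "tensor_class x = tensor_class y"
  proof (rule Set.set_eqI)
    fix z
    show "z \<in> tensor_class x \<longleftrightarrow> z \<in> tensor_class y"
      using tensor_rat_relations_add[OF _ *, of "z - x"] tensor_rat_relations_diff[OF _ *, of "z - y"]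
      by (auto simp: mem_tensor_class)
  qed
qed

lemma carrier_tensor_rat:
  "carrier (tensor_rat G) = tensor_class ` {x. Poly_Mapping.keys x \<subseteq> carrier G \<times> UNIV}"
proof -
  have "carrier (tensor_rat_free G) = {x. Poly_Mapping.keys x \<subseteq> carrier G \<times> UNIV}" by auto
  then show ?thesis by (simp add: tensor_rat_def Let_def carrier_FactGroup tensor_class_def)
qed

lemma add_tensor_rat:
  assumes "Poly_Mapping.keys x \<subseteq> carrier G \<times> UNIV" "Poly_Mapping.keys y \<subseteq> carrier G \<times> UNIV"
  shows "tensor_class x \<oplus>\<^bsub>tensor_rat G\<^esub> tensor_class y = tensor_class (x + y)"
proof -
  interpret F: comm_group "tensor_rat_free G" by (rule comm_group_tensor_rat_free)
  interpret N: normal "tensor_rat_relations G" "tensor_rat_free G"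
    by (rule F.subgroup_imp_normal[OF subgroup_tensor_rat_relations])
  show ?thesis
    using N.rcos_sum[of x y] assms unfolding tensor_rat_def Let_def tensor_class_def by simp
qed

lemma smult_tensor_rat:
  "q \<odot>\<^bsub>tensor_rat G\<^esub> tensor_class x = tensor_class (tensor_scale q x)"
proof -
  have "q \<odot>\<^bsub>tensor_rat G\<^esub> tensor_class x = (\<Union>c\<in>tensor_class x. tensor_class (tensor_scale q c))"
    by (simp add: tensor_rat_def Let_def tensor_class_def tensor_scale_def)
  also have "\<dots> = (\<Union>c\<in>tensor_class x. tensor_class (tensor_scale q x))"
    using tensor_scale_relations[of "_ - x" q] by (intro SUP_cong) (simp_all add: tensor_class_eq_iff mem_tensor_class)
  also have "\<dots> = tensor_class (tensor_scale q x)"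
    using mem_tensor_class[of x x] tensor_rat_relations_zero by auto
  finally show ?thesis .
qed

lemma tensor_scale_add_scalar:
  assumes "Poly_Mapping.keys x \<subseteq> carrier G \<times> UNIV"
  shows "tensor_scale (p + q) x - (tensor_scale p x + tensor_scale q x) \<in> tensor_rat_relations G"
  using assms
proof (induction x rule: formal_sum_induct)
  case (diff x y)
  from tensor_rat_relations_diff[OF this(3,4)] show ?case by (simp add: algebra_simps)
next
  case (of a)
  then obtain g r where a: "a = (g, r)" "g \<in> carrier G" by auto
  then show ?case using tensor_rat_relations_right[of g "p * r" "q * r"] by (simp add: algebra_simps)
qed (use tensor_rat_relations_zero in auto)

lemma vectorspace_tensor_rat: "vectorspace rat_field (tensor_rat G)"
proof -
  interpret K: field rat_field by (rule field_rat_field)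
  interpret F: comm_group "tensor_rat_free G" by (rule comm_group_tensor_rat_free)
  interpret C: comm_group "tensor_rat_free G Mod tensor_rat_relations G"
    by (rule F.abelian_FactGroup[OF subgroup_tensor_rat_relations])
  have ab: "abelian_group (tensor_rat G)"
  proof (rule abelian_groupI)
    show "\<exists>y\<in>carrier (tensor_rat G). y \<oplus>\<^bsub>tensor_rat G\<^esub> x = \<zero>\<^bsub>tensor_rat G\<^esub>"
      if "x \<in> carrier (tensor_rat G)" for x
      using that C.l_inv_ex[of x] by (simp add: tensor_rat_def Let_def del: mult_FactGroup one_FactGroup)
  next
    show "(x \<oplus>\<^bsub>tensor_rat G\<^esub> y) \<oplus>\<^bsub>tensor_rat G\<^esub> z = x \<oplus>\<^bsub>tensor_rat G\<^esub> (y \<oplus>\<^bsub>tensor_rat G\<^esub> z)"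
      if "x \<in> carrier (tensor_rat G)" "y \<in> carrier (tensor_rat G)" "z \<in> carrier (tensor_rat G)" for x y z
      using that C.m_assoc[of x y z] by (simp add: tensor_rat_def Let_def del: mult_FactGroup one_FactGroup)
  next
    show "x \<oplus>\<^bsub>tensor_rat G\<^esub> y = y \<oplus>\<^bsub>tensor_rat G\<^esub> x"
      if "x \<in> carrier (tensor_rat G)" "y \<in> carrier (tensor_rat G)" for x y
      using that C.m_comm[of x y] by (simp add: tensor_rat_def Let_def del: mult_FactGroup one_FactGroup)
  qed (simp_all add: tensor_rat_def Let_def del: mult_FactGroup one_FactGroup)
  have "module rat_field (tensor_rat G)"
  proof (rule module.intro)
    show "module_axioms rat_field (tensor_rat G)"
    proof
      fix p q and X Y
      {
        assume "X \<in> carrier (tensor_rat G)"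
        then obtain x where x: "X = tensor_class x" "Poly_Mapping.keys x \<subseteq> carrier G \<times> UNIV"
          by (auto simp: carrier_tensor_rat)
        show "p \<odot>\<^bsub>tensor_rat G\<^esub> X \<in> carrier (tensor_rat G)"
          unfolding x(1) smult_tensor_rat carrier_tensor_rat by (intro imageI CollectI tensor_scale_keys x(2))
        show "(p \<oplus>\<^bsub>rat_field\<^esub> q) \<odot>\<^bsub>tensor_rat G\<^esub> X = p \<odot>\<^bsub>tensor_rat G\<^esub> X \<oplus>\<^bsub>tensor_rat G\<^esub> q \<odot>\<^bsub>tensor_rat G\<^esub> X"
          unfolding x(1) smult_tensor_rat add_tensor_rat[OF tensor_scale_keys[OF x(2)] tensor_scale_keys[OF x(2)]]
            tensor_class_eq_iff
          using tensor_scale_add_scalar[OF x(2)] by (simp add: rat_field_def)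
        show "(p \<otimes>\<^bsub>rat_field\<^esub> q) \<odot>\<^bsub>tensor_rat G\<^esub> X = p \<odot>\<^bsub>tensor_rat G\<^esub> (q \<odot>\<^bsub>tensor_rat G\<^esub> X)"
          unfolding x(1) smult_tensor_rat tensor_scale_scale by (simp add: rat_field_def)
        show "\<one>\<^bsub>rat_field\<^esub> \<odot>\<^bsub>tensor_rat G\<^esub> X = X"
          unfolding x(1) smult_tensor_rat by (simp add: rat_field_def tensor_scale_one)
        assume "Y \<in> carrier (tensor_rat G)"
        then obtain y where y: "Y = tensor_class y" "Poly_Mapping.keys y \<subseteq> carrier G \<times> UNIV"
          by (auto simp: carrier_tensor_rat)
        show "p \<odot>\<^bsub>tensor_rat G\<^esub> (X \<oplus>\<^bsub>tensor_rat G\<^esub> Y) = p \<odot>\<^bsub>tensor_rat G\<^esub> X \<oplus>\<^bsub>tensor_rat G\<^esub> p \<odot>\<^bsub>tensor_rat G\<^esub> Y"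
          unfolding x(1) y(1) smult_tensor_rat add_tensor_rat[OF x(2) y(2)]
            add_tensor_rat[OF tensor_scale_keys[OF x(2)] tensor_scale_keys[OF y(2)]] by simp
      }
    qed
  qed (rule K.is_cring ab)+
  then show ?thesis by (simp add: vectorspace_def field_rat_field)
qed

lemma tensor_class_pow:
  assumes "a \<in> carrier G"
  shows "tensor_class (frag_of (a [^] (n::nat), p)) = tensor_class (frag_of (a, of_nat n * p))"
proof (induction n)
  case 0
  have "frag_of (\<one>, p) \<in> tensor_rat_relations G" "frag_of (a, 0) \<in> tensor_rat_relations G"
    using tensor_rat_relations_minus[OF tensor_rat_relations_left[of \<one> \<one> p]]
      tensor_rat_relations_minus[OF tensor_rat_relations_right[of a 0 0]] assms by simp_all
  then show ?case by (simp add: tensor_class_eq_iff tensor_rat_relations_diff)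
next
  case (Suc n)
  have 1: "frag_of (a [^] n \<otimes> a, p) - frag_of (a [^] n, p) - frag_of (a, p) \<in> tensor_rat_relations G"
    using assms by (intro tensor_rat_relations_left) auto
  have 2: "frag_of (a, of_nat n * p + p) - frag_of (a, of_nat n * p) - frag_of (a, p) \<in> tensor_rat_relations G"
    by (rule tensor_rat_relations_right[OF assms])
  from tensor_rat_relations_add[OF tensor_rat_relations_diff[OF 1 2] Suc[unfolded tensor_class_eq_iff]]
  show ?case by (simp add: tensor_class_eq_iff algebra_simps)
qed

lemma tensor_class_inv:
  assumes "a \<in> carrier G"
  shows "tensor_class (frag_of (inv a, p)) = tensor_class (frag_of (a, - p))"
proof -
  have 1: "frag_of (\<one>, p) \<in> tensor_rat_relations G" "frag_of (a, 0) \<in> tensor_rat_relations G"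
    using tensor_rat_relations_minus[OF tensor_rat_relations_left[of \<one> \<one> p]]
      tensor_rat_relations_minus[OF tensor_rat_relations_right[of a 0 0]] assms by simp_all
  have 2: "frag_of (\<one>, p) - frag_of (a, p) - frag_of (inv a, p) \<in> tensor_rat_relations G"
    using tensor_rat_relations_left[of a "inv a" p] assms by simp
  have 3: "frag_of (a, 0) - frag_of (a, p) - frag_of (a, - p) \<in> tensor_rat_relations G"
    using tensor_rat_relations_right[of a p "- p"] assms by simp
  from tensor_rat_relations_diff[OF tensor_rat_relations_add[OF tensor_rat_relations_diff[OF 3 2] 1(1)] 1(2)]
  show ?thesis by (simp add: tensor_class_eq_iff)
qed

text \<open>
  Integers move across the tensor sign, so a relation \<open>a\<^sup>m = b\<^sup>n\<close> can be divided by \<open>m\<close> in the second factor.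
\<close>
lemma tensor_class_int_pow:
  assumes "a \<in> carrier G"
  shows "tensor_class (frag_of (a [^] (n::int), p)) = tensor_class (frag_of (a, of_int n * p))"
proof (cases n rule: int_cases2)
  case (nonneg m)
  then show ?thesis using tensor_class_pow[OF assms] by (simp add: int_pow_int)
next
  case (nonpos m)
  then show ?thesis using tensor_class_pow[OF assms, of m "- p"] tensor_class_inv[of "a [^] m" p] assms
    by (simp add: int_pow_neg int_pow_int)
qed

text \<open>
  If \<open>a\<^sup>m = b\<^sup>n\<close> with \<open>m \<noteq> 0\<close>, then \<open>a \<otimes> p = a\<^sup>m \<otimes> (p / m) = b\<^sup>n \<otimes> (p / m) = b \<otimes> (n p / m)\<close>. So every tensor is a
  multiple of \<open>b \<otimes> 1\<close>.
\<close>
lemma dim_tensor_rat_le_1: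
  assumes b: "b \<in> carrier G"
    and dep: "\<And>a. a \<in> carrier G \<Longrightarrow> \<exists>(m::int) (n::int). m \<noteq> 0 \<and> a [^] m = b [^] n"
  shows "vectorspace.dim rat_field (tensor_rat G) \<le> 1"
proof -
  interpret V: vectorspace rat_field "tensor_rat G" by (rule vectorspace_tensor_rat)
  have smult: "q \<odot>\<^bsub>tensor_rat G\<^esub> tensor_class (frag_of (b, 1)) = tensor_class (frag_of (b, q))" for q
    by (simp add: smult_tensor_rat)
  have cl: "tensor_class (frag_of (a, q)) \<in> carrier (tensor_rat G)" if "a \<in> carrier G" for a q
    using that by (auto simp: carrier_tensor_rat)
  have line: "\<exists>q. tensor_class x = tensor_class (frag_of (b, q))"
    if "Poly_Mapping.keys x \<subseteq> carrier G \<times> UNIV" for x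
    using that
  proof (induction x rule: formal_sum_induct)
    case zero
    have "frag_of (b, 0) \<in> tensor_rat_relations G"
      using tensor_rat_relations_minus[OF tensor_rat_relations_right[of b 0 0]] b by simp
    then have "tensor_class 0 = tensor_class (frag_of (b, 0))"
      using tensor_rat_relations_minus by (auto simp: tensor_class_eq_iff)
    then show ?case by blast
  next
    case (diff x y)
    then obtain p q where p: "x - frag_of (b, p) \<in> tensor_rat_relations G"
      and q: "y - frag_of (b, q) \<in> tensor_rat_relations G"
      unfolding tensor_class_eq_iff by blast
    have pq: "frag_of (b, p) - frag_of (b, p - q) - frag_of (b, q) \<in> tensor_rat_relations G"
      using tensor_rat_relations_right[OF b, of "p - q" q] by simp
    from tensor_rat_relations_add[OF tensor_rat_relations_diff[OF p q] pq]
    have "tensor_class (x - y) = tensor_class (frag_of (b, p - q))"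
      by (simp add: tensor_class_eq_iff algebra_simps)
    then show ?case by blast
  next
    case (of c)
    then obtain a p where c: "c = (a, p)" "a \<in> carrier G" by auto
    from dep[OF c(2)] obtain m n :: int where mn: "m \<noteq> 0" "a [^] m = b [^] n" by blast
    have "tensor_class (frag_of (a, p)) = tensor_class (frag_of (a, of_int m * (p / of_int m)))"
      using mn by simp
    also have "\<dots> = tensor_class (frag_of (a [^] m, p / of_int m))"
      by (rule tensor_class_int_pow[OF c(2), symmetric])
    also have "\<dots> = tensor_class (frag_of (b, of_int n * (p / of_int m)))"
      unfolding mn(2) by (rule tensor_class_int_pow[OF b])
    finally show ?case using c by blast
  qed
  show ?thesis
  proof (rule V.dim_le_1_if_all_multiples[OF cl[OF b]])
    fix X assume "X \<in> carrier (tensor_rat G)"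
    then obtain x where x: "X = tensor_class x" "Poly_Mapping.keys x \<subseteq> carrier G \<times> UNIV"
      by (auto simp: carrier_tensor_rat)
    from line[OF x(2)] obtain q where "X = q \<odot>\<^bsub>tensor_rat G\<^esub> tensor_class (frag_of (b, 1))"
      unfolding x(1) smult ..
    then show "\<exists>q\<in>carrier rat_field. X = q \<odot>\<^bsub>tensor_rat G\<^esub> tensor_class (frag_of (b, 1))"
      by (intro bexI[of _ q]) (simp_all add: rat_field_def)
  qed
qed

end

section \<open>Locally finite functions on the line\<close>

definition locally_finite_fun :: "(real \<Rightarrow> int) \<Rightarrow> bool" where
  "locally_finite_fun f \<longleftrightarrow> (\<forall>R. finite {t. \<bar>t\<bar> \<le> R \<and> f t \<noteq> 0})"

lemma locally_finite_funD: "locally_finite_fun f \<Longrightarrow> finite {t. \<bar>t\<bar> \<le> R \<and> f t \<noteq> 0}"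
  by (simp add: locally_finite_fun_def)

lemma locally_finite_fun_diff:
  assumes "locally_finite_fun f" "locally_finite_fun g"
  shows "locally_finite_fun (\<lambda>t. f t - g t)"
  unfolding locally_finite_fun_def
proof
  fix R :: real
  have "{t. \<bar>t\<bar> \<le> R \<and> f t - g t \<noteq> 0} \<subseteq> {t. \<bar>t\<bar> \<le> R \<and> f t \<noteq> 0} \<union> {t. \<bar>t\<bar> \<le> R \<and> g t \<noteq> 0}"
    by auto
  then show "finite {t. \<bar>t\<bar> \<le> R \<and> f t - g t \<noteq> 0}"
    by (rule finite_subset) (simp add: assms locally_finite_funD)
qed

lemma locally_finite_fun_translate:
  assumes "locally_finite_fun f"
  shows "locally_finite_fun (\<lambda>t. f (t - c))"
  unfolding locally_finite_fun_def
proof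
  fix R :: real
  have "{t. \<bar>t\<bar> \<le> R \<and> f (t - c) \<noteq> 0} \<subseteq> (\<lambda>s. s + c) ` {s. \<bar>s\<bar> \<le> R + \<bar>c\<bar> \<and> f s \<noteq> 0}"
  proof
    fix t assume t: "t \<in> {t. \<bar>t\<bar> \<le> R \<and> f (t - c) \<noteq> 0}"
    then have "t - c \<in> {s. \<bar>s\<bar> \<le> R + \<bar>c\<bar> \<and> f s \<noteq> 0}" by auto
    moreover have "t = (t - c) + c" by simp
    ultimately show "t \<in> (\<lambda>s. s + c) ` {s. \<bar>s\<bar> \<le> R + \<bar>c\<bar> \<and> f s \<noteq> 0}" by (rule rev_image_eqI)
  qed
  then show "finite {t. \<bar>t\<bar> \<le> R \<and> f (t - c) \<noteq> 0}"
    by (rule finite_subset) (intro finite_imageI locally_finite_funD assms)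
qed

lemma abs_le_bound_int:
  assumes "\<bar>of_int i * b\<bar> \<le> C" "b > (0::real)"
  shows "i \<in> {- \<lceil>C / b\<rceil> .. \<lceil>C / b\<rceil>}"
proof -
  have "\<bar>of_int i\<bar> \<le> C / b" using assms by (simp add: abs_mult pos_le_divide_eq)
  then have "real_of_int i \<le> of_int \<lceil>C / b\<rceil>" "real_of_int (- \<lceil>C / b\<rceil>) \<le> of_int i" by linarith+
  then show ?thesis unfolding of_int_le_iff by simp
qed

text \<open>
  On each coset of \<open>b\<int>\<close> the equation is a recursion that may be started with \<open>k = 0\<close> just left of the
  origin. Then \<open>k t\<close> only involves values of \<open>f\<close> at points between \<open>0\<close> and \<open>t\<close>, which keeps it locally
  finite.
\<close>
lemma locally_finite_primitive:
  assumes f: "locally_finite_fun f" and b: "b > 0"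
  shows "\<exists>k. locally_finite_fun k \<and> (\<forall>t. k t - k (t - b) = f t)"
proof (intro exI conjI allI)
  \<comment> \<open>At most one of the two index sets is nonempty: the first sum runs back from \<open>t\<close> to the
    origin when \<open>t \<ge> 0\<close>, the second one forward from \<open>t + b\<close> when \<open>t < 0\<close>.\<close>
  define K where "K n t = (\<Sum>i\<in>{0..n}. f (t - of_int i * b)) - (\<Sum>i\<in>{n+1..-1}. f (t - of_int i * b))" for n :: int and t
  define k where "k t = K \<lfloor>t / b\<rfloor> t" for t
  show "locally_finite_fun k"
    unfolding locally_finite_fun_def
  proof
    fix R :: real
    define N where "N = \<lceil>2 * R / b\<rceil>"
    have "{t. \<bar>t\<bar> \<le> R \<and> k t \<noteq> 0} \<subseteq> (\<Union>i\<in>{-N..N}. (\<lambda>s. s + of_int i * b) ` {s. \<bar>s\<bar> \<le> R \<and> f s \<noteq> 0})"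
    proof clarify
      fix t assume t: "\<bar>t\<bar> \<le> R" "k t \<noteq> 0"
      define n where "n = \<lfloor>t / b\<rfloor>"
      have n: "of_int n * b \<le> t" "t < (of_int n + 1) * b"
        using b floor_divide_lower[of b t] floor_divide_upper[of b t] by (simp_all add: n_def)
      have "\<exists>i. (i \<in> {0..n} \<or> i \<in> {n+1..-1}) \<and> f (t - of_int i * b) \<noteq> 0"
      proof (rule ccontr)
        assume "\<not> ?thesis"
        then have "\<forall>i\<in>{0..n}. f (t - of_int i * b) = 0" "\<forall>i\<in>{n+1..-1}. f (t - of_int i * b) = 0"
          by blast+
        then have "K n t = 0" unfolding K_def by (simp only: sum.neutral)
        with t show False by (simp add: k_def n_def)
      qed
      then obtain i where i: "i \<in> {0..n} \<or> i \<in> {n+1..-1}" and fi: "f (t - of_int i * b) \<noteq> 0" by blast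
      have bound: "\<bar>t - of_int i * b\<bar> \<le> \<bar>t\<bar>"
      proof (cases "i \<in> {0..n}")
        case True
        then have "0 \<le> of_int i * b" "of_int i * b \<le> of_int n * b"
          using b by (auto intro!: mult_right_mono)
        with n show ?thesis by linarith
      next
        case False
        with i have "n + 1 \<le> i" "i \<le> -1" by auto
        then have "of_int i * b \<le> 0" "of_int (n + 1) * b \<le> of_int i * b"
          using b by (auto intro!: mult_right_mono mult_nonpos_nonneg simp del: of_int_add)
        with n show ?thesis by simp
      qed
      then have "\<bar>of_int i * b\<bar> \<le> 2 * R" using t(1) by linarith
      then have "i \<in> {-N..N}" unfolding N_def using b by (rule abs_le_bound_int)
      moreover have "t - of_int i * b \<in> {s. \<bar>s\<bar> \<le> R \<and> f s \<noteq> 0}" using bound t(1) fi by simp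
      then have "t \<in> (\<lambda>s. s + of_int i * b) ` {s. \<bar>s\<bar> \<le> R \<and> f s \<noteq> 0}"
        by (rule rev_image_eqI) simp
      ultimately show "t \<in> (\<Union>i\<in>{-N..N}. (\<lambda>s. s + of_int i * b) ` {s. \<bar>s\<bar> \<le> R \<and> f s \<noteq> 0})" by blast
    qed
    then show "finite {t. \<bar>t\<bar> \<le> R \<and> k t \<noteq> 0}"
      by (rule finite_subset) (intro finite_UN_I finite_imageI locally_finite_funD f, simp)
  qed
  show "k t - k (t - b) = f t" for t
  proof -
    define n where "n = \<lfloor>t / b\<rfloor>"
    have n': "\<lfloor>(t - b) / b\<rfloor> = n - 1" using b by (simp add: n_def diff_divide_distrib)
    define g where "g i = f (t - of_int i * b)" for i
    have g': "f (t - b - of_int i * b) = g (i + 1)" for i by (simp add: g_def algebra_simps)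
    have sh: "(\<Sum>i\<in>{p..q}. g (i + 1)) = (\<Sum>i\<in>{p+1..q+1}. g i)" for p q
      by (rule sum.reindex_bij_witness[of _ "\<lambda>i. i - 1" "\<lambda>i. i + 1"]) auto
    have k1: "k t = (\<Sum>i\<in>{0..n}. g i) - (\<Sum>i\<in>{n+1..-1}. g i)"
      by (simp add: k_def K_def n_def g_def)
    have k2: "k (t - b) = (\<Sum>i\<in>{1..n}. g i) - (\<Sum>i\<in>{n+1..0}. g i)"
      unfolding k_def K_def n' g' sh by simp
    have "k t - k (t - b) = g 0"
    proof (cases "n \<ge> 0")
      case True
      then have "{0..n} = insert 0 {1..n}" by auto
      with True show ?thesis by (simp add: k1 k2)
    next
      case False
      then have "{n+1..0} = insert 0 {n+1..-1}" by auto
      with False show ?thesis by (simp add: k1 k2)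
    qed
    then show ?thesis by (simp add: g_def)
  qed
qed

lemma periodic_of_int:
  fixes f :: "real \<Rightarrow> int"
  assumes "\<And>t. f (t - b) = f t"
  shows "f (t + of_int m * b) = f t"
proof -
  have nat: "f (t + of_nat n * b) = f t" for n t
  proof (induction n)
    case (Suc n)
    have "f (t + of_nat (Suc n) * b) = f ((t + of_nat (Suc n) * b) - b)" by (simp only: assms)
    also have "\<dots> = f (t + of_nat n * b)" by (simp add: algebra_simps)
    finally show ?case using Suc by simp
  qed simp
  show ?thesis
  proof (cases m rule: int_cases2)
    case (nonneg n)
    then show ?thesis using nat[of t n] by simp
  next
    case (nonpos n)
    then show ?thesis using nat[of "t + of_int m * b" n] by simp
  qed
qed

text \<open>The representative in \<open>[0, b)\<close> of the class of \<open>t\<close> in the circle \<open>\<real> / b\<int>\<close>.\<close>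
definition reduce_mod :: "real \<Rightarrow> real \<Rightarrow> real" where
  "reduce_mod b t = t - of_int \<lfloor>t / b\<rfloor> * b"

lemma reduce_mod_bounds:
  assumes "b > 0"
  shows "0 \<le> reduce_mod b t" "reduce_mod b t < b"
  using assms floor_divide_lower[of b t] floor_divide_upper[of b t]
  by (simp_all add: reduce_mod_def algebra_simps)

lemma reduce_mod_unique:
  assumes "b > 0" "0 \<le> t + of_int m * b" "t + of_int m * b < b"
  shows "reduce_mod b t = t + of_int m * b"
proof -
  have "\<lfloor>t / b\<rfloor> = - m"
    using assms by (intro floor_unique) (simp_all add: field_simps)
  then show ?thesis by (simp add: reduce_mod_def)
qed

lemma periodic_reduce_mod:
  fixes f :: "real \<Rightarrow> int"
  assumes "\<And>t. f (t - b) = f t"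
  shows "f (reduce_mod b t) = f t"
  using periodic_of_int[of f b t "- \<lfloor>t / b\<rfloor>", OF assms] by (simp add: reduce_mod_def)

lemma locally_finite_fun_if_periodic:
  assumes b: "b > 0" and per: "\<And>t. f (t - b) = f t"
    and fin: "finite {t. 0 \<le> t \<and> t < b \<and> f t \<noteq> 0}"
  shows "locally_finite_fun f"
  unfolding locally_finite_fun_def
proof
  fix R :: real
  define N where "N = \<lceil>(R + b) / b\<rceil>"
  have "{t. \<bar>t\<bar> \<le> R \<and> f t \<noteq> 0} \<subseteq> (\<Union>i\<in>{-N..N}. (\<lambda>s. s + of_int i * b) ` {t. 0 \<le> t \<and> t < b \<and> f t \<noteq> 0})"
  proof clarify
    fix t assume t: "\<bar>t\<bar> \<le> R" "f t \<noteq> 0"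
    define i where "i = \<lfloor>t / b\<rfloor>"
    have r: "reduce_mod b t = t - of_int i * b" by (simp add: reduce_mod_def i_def)
    have "\<bar>of_int i * b\<bar> \<le> R + b" using r reduce_mod_bounds[OF b, of t] t(1) by linarith
    then have "i \<in> {-N..N}" unfolding N_def using b by (rule abs_le_bound_int)
    moreover have "reduce_mod b t \<in> {t. 0 \<le> t \<and> t < b \<and> f t \<noteq> 0}"
      using reduce_mod_bounds[OF b, of t] t(2) periodic_reduce_mod[of f b t, OF per] by simp
    then have "t \<in> (\<lambda>s. s + of_int i * b) ` {t. 0 \<le> t \<and> t < b \<and> f t \<noteq> 0}"
      by (rule rev_image_eqI) (simp add: r)
    ultimately show "t \<in> (\<Union>i\<in>{-N..N}. (\<lambda>s. s + of_int i * b) ` {t. 0 \<le> t \<and> t < b \<and> f t \<noteq> 0})" by blast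
  qed
  then show "finite {t. \<bar>t\<bar> \<le> R \<and> f t \<noteq> 0}"
    by (rule finite_subset) (intro finite_UN_I finite_imageI fin, simp)
qed

text \<open>For \<open>b \<noteq> 0\<close> this says that \<open>a / b\<close> is irrational.\<close>
definition incommensurable :: "real \<Rightarrow> real \<Rightarrow> bool" where
  "incommensurable a b \<longleftrightarrow> (\<forall>i m. of_int i * a + of_int m * b = 0 \<longrightarrow> i = 0)"

lemma Sum_any_shift: "Sum_any (\<lambda>i::int. g (i + c)) = Sum_any g"
  by (rule sym, rule Sum_any.reindex_cong[of "\<lambda>i. i + c"])
     (auto simp: bij_plus_right fun_eq_iff intro: bij_betw_byWitness[of _ "\<lambda>i. i - c"])

lemma Sum_any_reflect: "Sum_any (\<lambda>i::int. g (c - i)) = Sum_any g"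
  by (rule sym, rule Sum_any.reindex_cong[of "\<lambda>i. c - i"])
     (auto simp: fun_eq_iff intro: bij_betw_byWitness[of _ "\<lambda>i. c - i"])

text \<open>
  Functions with period \<open>b\<close> live on the circle \<open>\<real> / b\<int>\<close>, where the locally finite ones are exactly those of
  finite support and where translation by \<open>a\<close> acts with infinite orbits.
\<close>
locale irrational_rotation =
  fixes a b :: real
  assumes b: "b > 0" and indep: "incommensurable a b"
begin

lemma orbit_inj:
  assumes "reduce_mod b (t + of_int i * a) = reduce_mod b (t + of_int j * a)"
  shows "i = j"
proof -
  have "of_int (i - j) * a + of_int (\<lfloor>(t + of_int j * a) / b\<rfloor> - \<lfloor>(t + of_int i * a) / b\<rfloor>) * b = 0"
    using assms by (simp add: reduce_mod_def algebra_simps)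
  then have "i - j = 0" using indep unfolding incommensurable_def by blast
  then show ?thesis by simp
qed

lemma finite_fundamental:
  assumes "locally_finite_fun f"
  shows "finite {t. 0 \<le> t \<and> t < b \<and> f t \<noteq> 0}"
  by (rule finite_subset[OF _ locally_finite_funD[OF assms, of b]]) auto

text \<open>The points of an orbit are distinct on the circle, so only finitely many meet a finite support.\<close>
lemma finite_orbit:
  assumes f: "locally_finite_fun f" and per: "\<And>t. f (t - b) = f t"
  shows "finite {i. f (t + of_int i * a) \<noteq> 0}"
proof (rule finite_imageD)
  show "inj_on (\<lambda>i. reduce_mod b (t + of_int i * a)) {i. f (t + of_int i * a) \<noteq> 0}"
    by (rule inj_onI) (rule orbit_inj)
  show "finite ((\<lambda>i. reduce_mod b (t + of_int i * a)) ` {i. f (t + of_int i * a) \<noteq> 0})"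
    by (rule finite_subset[OF _ finite_fundamental[OF f]])
       (auto simp: reduce_mod_bounds[OF b] periodic_reduce_mod[of f, OF per])
qed

text \<open>
  The sum of \<open>f\<close> over the orbit of \<open>t\<close> on the circle. It is the obstruction to writing a finitely
  supported \<open>f\<close> as \<open>k - k (\<cdot> - a)\<close> with \<open>k\<close> finitely supported.
\<close>
definition charge :: "(real \<Rightarrow> int) \<Rightarrow> real \<Rightarrow> int" where
  "charge f t = Sum_any (\<lambda>i::int. f (t + of_int i * a))"

text \<open>The right-hand side of the equation has charge zero, since its sum over an orbit telescopes.\<close>
lemma charge_translate_eq:
  assumes f: "locally_finite_fun f" "\<And>t. f (t - b) = f t"
    and u: "locally_finite_fun u" "\<And>t. u (t - b) = u t"
    and eq: "\<And>t. f t - f (t - c) = u t - u (t - a)"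
  shows "charge f t = charge f (t - c)"
proof -
  have fin: "finite {i. f (s + of_int i * a) \<noteq> 0}" "finite {i. u (s + of_int i * a) \<noteq> 0}" for s
    using finite_orbit[OF f] finite_orbit[OF u] by auto
  have "f (t + of_int i * a) + u ((t - a) + of_int i * a) = f ((t - c) + of_int i * a) + u (t + of_int i * a)" for i
    using eq[of "t + of_int i * a"] by (simp add: algebra_simps)
  then have "Sum_any (\<lambda>i. f (t + of_int i * a) + u ((t - a) + of_int i * a))
      = Sum_any (\<lambda>i. f ((t - c) + of_int i * a) + u (t + of_int i * a))"
    by (rule Sum_any.cong)
  then have "charge f t + charge u (t - a) = charge f (t - c) + charge u t"
    by (simp add: Sum_any.distrib fin charge_def)
  moreover have "charge u (t - a) = charge u t"
    unfolding charge_def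
    using Sum_any_shift[of "\<lambda>i. u (t + of_int i * a)" "-1"] by (simp add: algebra_simps)
  ultimately show ?thesis by simp
qed

text \<open>
  Group the support of \<open>f\<close> in one period by orbits. Each group contributes \<open>n\<close> to the total, and there is
  at least one group.
\<close>
lemma charge_eq_0:
  assumes f: "locally_finite_fun f" "\<And>t. f (t - b) = f t"
    and const: "\<And>t. f t \<noteq> 0 \<Longrightarrow> charge f t = n"
    and total: "(\<Sum>t | 0 \<le> t \<and> t < b \<and> f t \<noteq> 0. f t) = 0"
    and t: "f t \<noteq> 0"
  shows "n = 0"
proof -
  define P where "P = {t. 0 \<le> t \<and> t < b \<and> f t \<noteq> 0}"
  have finP: "finite P" unfolding P_def by (rule finite_fundamental[OF f(1)])
  define cls where "cls s = {s' \<in> P. \<exists>i m. s' = s + of_int i * a + of_int m * b}" for s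
  have cls_self: "s \<in> cls s" if "s \<in> P" for s
    using that unfolding cls_def by (auto intro!: exI[of _ 0])
  have cls_eq: "cls s = cls s'" if s: "s' \<in> cls s" for s s'
  proof -
    from s obtain i m where im: "s' = s + of_int i * a + of_int m * b" unfolding cls_def by auto
    have "(\<exists>j l. x = s + of_int j * a + of_int l * b) \<longleftrightarrow> (\<exists>j l. x = s' + of_int j * a + of_int l * b)" for x
    proof
      assume "\<exists>j l. x = s + of_int j * a + of_int l * b"
      then obtain j l where "x = s + of_int j * a + of_int l * b" by blast
      then have "x = s' + of_int (j - i) * a + of_int (l - m) * b" by (simp add: im algebra_simps)
      then show "\<exists>j l. x = s' + of_int j * a + of_int l * b" by blast
    next
      assume "\<exists>j l. x = s' + of_int j * a + of_int l * b"
      then obtain j l where "x = s' + of_int j * a + of_int l * b" by blast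
      then have "x = s + of_int (j + i) * a + of_int (l + m) * b" by (simp add: im algebra_simps)
      then show "\<exists>j l. x = s + of_int j * a + of_int l * b" by blast
    qed
    then show ?thesis unfolding cls_def by simp
  qed
  have fibre: "{x \<in> P. cls x = cls s} = cls s" if "s \<in> P" for s
  proof
    show "{x \<in> P. cls x = cls s} \<subseteq> cls s" using cls_self by blast
    show "cls s \<subseteq> {x \<in> P. cls x = cls s}" using cls_eq unfolding cls_def by blast
  qed
  have orbit_sum: "sum f (cls s) = n" if s: "s \<in> P" for s
  proof -
    have "sum f (cls s) = sum (\<lambda>i. f (s + of_int i * a)) {i. f (s + of_int i * a) \<noteq> 0}"
    proof (rule sum.reindex_cong[of "\<lambda>i. reduce_mod b (s + of_int i * a)"])
      show "inj_on (\<lambda>i. reduce_mod b (s + of_int i * a)) {i. f (s + of_int i * a) \<noteq> 0}"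
        by (rule inj_onI) (rule orbit_inj)
      show "cls s = (\<lambda>i. reduce_mod b (s + of_int i * a)) ` {i. f (s + of_int i * a) \<noteq> 0}"
      proof (intro equalityI subsetI)
        fix x assume "x \<in> cls s"
        then obtain i m where x: "x \<in> P" "x = s + of_int i * a + of_int m * b" unfolding cls_def by auto
        then have xr: "x = reduce_mod b (s + of_int i * a)"
          using reduce_mod_unique[OF b, of "s + of_int i * a" m] unfolding P_def by simp
        with x(1) have "f (s + of_int i * a) \<noteq> 0"
          using periodic_reduce_mod[of f b, OF f(2)] unfolding P_def by simp
        with xr show "x \<in> (\<lambda>i. reduce_mod b (s + of_int i * a)) ` {i. f (s + of_int i * a) \<noteq> 0}"
          by blast
      next
        fix x assume "x \<in> (\<lambda>i. reduce_mod b (s + of_int i * a)) ` {i. f (s + of_int i * a) \<noteq> 0}"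
        then obtain i where i: "f (s + of_int i * a) \<noteq> 0" "x = reduce_mod b (s + of_int i * a)" by blast
        then have "x \<in> P"
          using periodic_reduce_mod[of f b, OF f(2)] reduce_mod_bounds[OF b] unfolding P_def by simp
        moreover have "x = s + of_int i * a + of_int (- \<lfloor>(s + of_int i * a) / b\<rfloor>) * b"
          by (simp add: i(2) reduce_mod_def)
        ultimately show "x \<in> cls s" unfolding cls_def by blast
      qed
    qed (simp add: periodic_reduce_mod[of f b, OF f(2)])
    also have "\<dots> = charge f s" by (simp add: charge_def Sum_any.expand_set)
    also have "\<dots> = n" using const s unfolding P_def by simp
    finally show ?thesis .
  qed
  have "0 = sum f P" using total by (simp add: P_def)
  also have "\<dots> = (\<Sum>y\<in>cls ` P. sum f {x \<in> P. cls x = y})"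
    by (rule sum.group[symmetric]) (use finP in auto)
  also have "\<dots> = (\<Sum>y\<in>cls ` P. n)"
    by (rule sum.cong) (auto simp: fibre orbit_sum)
  also have "\<dots> = of_nat (card (cls ` P)) * n" by simp
  finally have "card (cls ` P) = 0 \<or> n = 0" by simp
  moreover have "reduce_mod b t \<in> P"
    using t periodic_reduce_mod[of f b, OF f(2)] reduce_mod_bounds[OF b] unfolding P_def by simp
  ultimately show ?thesis using finP by auto
qed

text \<open>
  The solution is the sum of \<open>f\<close> along the backward orbit. Along the forward orbit of a point of the
  support these partial sums become the full charge, so that they vanish from some point on; hence the
  support of the solution is finite on the circle.
\<close>
lemma periodic_primitive:
  assumes f: "locally_finite_fun f" "\<And>t. f (t - b) = f t"
    and neutral: "\<And>t. f t \<noteq> 0 \<Longrightarrow> charge f t = 0"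
  shows "\<exists>k. locally_finite_fun k \<and> (\<forall>t. k (t - b) = k t) \<and> (\<forall>t. k t - k (t - a) = f t)"
proof (intro exI conjI allI)
  define k where "k t = Sum_any (\<lambda>i::int. if i \<ge> 0 then f (t - of_int i * a) else 0)" for t
  have fin: "finite {i. f (t - of_int i * a) \<noteq> 0}" for t
  proof -
    have "finite ((\<lambda>i. - i) ` {i. f (t + of_int i * a) \<noteq> 0})" using finite_orbit[OF f] by blast
    moreover have "{i. f (t - of_int i * a) \<noteq> 0} \<subseteq> (\<lambda>i. - i) ` {i. f (t + of_int i * a) \<noteq> 0}"
      by (auto intro!: image_eqI[of _ _ "- _"])
    ultimately show ?thesis by (rule rev_finite_subset)
  qed
  show per: "k (t - b) = k t" for t
  proof -
    have "f (t - b - of_int i * a) = f (t - of_int i * a)" for i :: int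
      using f(2)[of "t - of_int i * a"] by (simp add: algebra_simps)
    then show ?thesis unfolding k_def by (intro Sum_any.cong) simp
  qed
  show "k t - k (t - a) = f t" for t
  proof -
    define g where "g i = f (t - of_int i * a)" for i :: int
    have g: "finite {i. g i \<noteq> 0}" unfolding g_def by (rule fin)
    have "k (t - a) = Sum_any (\<lambda>i. if i + 1 \<ge> 1 then g (i + 1) else 0)"
      unfolding k_def g_def by (rule Sum_any.cong) (simp add: algebra_simps)
    also have "\<dots> = Sum_any (\<lambda>i. if i \<ge> 1 then g i else 0)"
      by (rule Sum_any_shift[of "\<lambda>i. if i \<ge> 1 then g i else 0"])
    finally have 1: "k (t - a) = Sum_any (\<lambda>i. if i \<ge> 1 then g i else 0)" .
    have "k t = Sum_any (\<lambda>i. (if i \<ge> 1 then g i else 0) + (if i = 0 then g i else 0))"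
      unfolding k_def g_def by (rule Sum_any.cong) auto
    also have "\<dots> = k (t - a) + Sum_any (\<lambda>i. if i = 0 then g i else 0)"
      unfolding 1 by (rule Sum_any.distrib) (auto intro: rev_finite_subset[OF g])
    also have "Sum_any (\<lambda>i. if i = 0 then g i else 0) = g 0" by simp
    finally show ?thesis by (simp add: g_def)
  qed
  show "locally_finite_fun k"
  proof (rule locally_finite_fun_if_periodic[of b k, OF b per])
    define P where "P = {t. 0 \<le> t \<and> t < b \<and> f t \<noteq> 0}"
    have finP: "finite P" unfolding P_def by (rule finite_fundamental[OF f(1)])
    have "\<exists>M. \<forall>i>M. f (p + of_int i * a) = 0" for p
    proof -
      have "bdd_above {i. f (p + of_int i * a) \<noteq> 0}" by (rule bdd_above_finite[OF finite_orbit[OF f]])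
      then obtain M where "\<And>i. f (p + of_int i * a) \<noteq> 0 \<Longrightarrow> i \<le> M" unfolding bdd_above_def by auto
      then show ?thesis by (metis not_le)
    qed
    \<comment> \<open>\<open>M p\<close> bounds the times at which the forward orbit of \<open>p\<close> meets the support.\<close>
    then obtain M where M: "\<And>p i. i > M p \<Longrightarrow> f (p + of_int i * a) = 0" by metis
    have vanish: "k (p + of_int i * a) = 0" if p: "p \<in> P" and i: "i > M p" for p i
    proof -
      define h where "h l = (if l \<le> i then f (p + of_int l * a) else 0)" for l
      have "k (p + of_int i * a) = Sum_any (\<lambda>j. h (i - j))"
        unfolding k_def h_def by (rule Sum_any.cong) (simp add: algebra_simps)
      also have "\<dots> = Sum_any h" by (rule Sum_any_reflect)
      also have "\<dots> = charge f p"
        unfolding charge_def h_def by (rule Sum_any.cong) (use M[of p] i in auto)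
      also have "\<dots> = 0" using neutral p unfolding P_def by simp
      finally show ?thesis .
    qed
    have "{t. 0 \<le> t \<and> t < b \<and> k t \<noteq> 0} \<subseteq> (\<Union>p\<in>P. (\<lambda>i. reduce_mod b (p + of_int i * a)) ` {0..M p})"
    proof clarify
      fix t assume t: "0 \<le> t" "t < b" "k t \<noteq> 0"
      from t(3) obtain i where "(if i \<ge> 0 then f (t - of_int i * a) else 0) \<noteq> 0"
        unfolding k_def by (rule Sum_any.not_neutral_obtains_not_neutral)
      then have i: "i \<ge> 0" "f (t - of_int i * a) \<noteq> 0" by (auto split: if_splits)
      define p where "p = reduce_mod b (t - of_int i * a)"
      have p: "p \<in> P"
        using i periodic_reduce_mod[of f b, OF f(2)] reduce_mod_bounds[OF b] unfolding P_def p_def by simp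
      obtain m where pm: "p = t - of_int i * a + of_int m * b"
        by (rule that[of "- \<lfloor>(t - of_int i * a) / b\<rfloor>"]) (simp add: p_def reduce_mod_def)
      have pt: "p + of_int i * a = t + of_int m * b" by (simp add: pm)
      have "k (p + of_int i * a) \<noteq> 0"
        unfolding pt using periodic_of_int[of k, OF per] t(3) by simp
      then have "i \<le> M p" using vanish[OF p] by (meson not_le)
      moreover have "t = reduce_mod b (p + of_int i * a)"
        using reduce_mod_unique[OF b, of "p + of_int i * a" "- m"] t(1,2) by (simp add: pt)
      ultimately show "t \<in> (\<Union>p\<in>P. (\<lambda>i. reduce_mod b (p + of_int i * a)) ` {0..M p})"
        using p i(1) by (intro UN_I[of p] image_eqI[of _ _ i]) simp_all
    qed
    then show "finite {t. 0 \<le> t \<and> t < b \<and> k t \<noteq> 0}"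
      by (rule finite_subset) (intro finite_UN_I finite_imageI finP, simp)
  qed
qed

lemma invariant_eq_0:
  assumes "locally_finite_fun D" "\<And>t. D (t - b) = D t" "\<And>t. D (t - a) = D t"
  shows "D t = 0"
proof (rule ccontr)
  assume "D t \<noteq> 0"
  then have "{i. D (t + of_int i * a) \<noteq> 0} = UNIV"
    using periodic_of_int[of D a, OF assms(3)] by simp
  then show False using finite_orbit[OF assms(1,2), of t] by simp
qed

text \<open>
  The condition \<open>total\<close> holds for the jumps of a cocycle of functions. It does not follow from the cocycle
  identity for \<open>J\<close>: for \<open>\<Gamma> = \<int>a + \<int>b\<close> it fails if \<open>J a\<close> is the indicator function of \<open>b\<int>\<close>. Since the cocycle is normalised along \<open>b\<close>, all \<open>J \<gamma>\<close> have period \<open>b\<close>, a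
  primitive of \<open>J a\<close> exists because the charge vanishes, and it is a primitive for every \<open>\<gamma>\<close> because the
  difference is invariant under \<open>a\<close> and \<open>b\<close>.
\<close>
lemma jump_cocycle_is_coboundary:
  assumes \<Gamma>: "a \<in> \<Gamma>" "b \<in> \<Gamma>"
    and add: "\<And>x y. x \<in> \<Gamma> \<Longrightarrow> y \<in> \<Gamma> \<Longrightarrow> x + y \<in> \<Gamma>"
    and J: "\<And>\<gamma>. \<gamma> \<in> \<Gamma> \<Longrightarrow> locally_finite_fun (J \<gamma>)"
    and supp: "\<And>\<gamma> t. \<gamma> \<in> \<Gamma> \<Longrightarrow> J \<gamma> t \<noteq> 0 \<Longrightarrow> t \<in> \<Gamma>"
    and cocycle: "\<And>\<gamma> \<delta> t. \<gamma> \<in> \<Gamma> \<Longrightarrow> \<delta> \<in> \<Gamma> \<Longrightarrow> J (\<gamma> + \<delta>) t = J \<gamma> t + J \<delta> (t - \<gamma>)"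
    and Jb: "\<And>t. J b t = 0"
    and total: "(\<Sum>t | 0 \<le> t \<and> t < b \<and> J a t \<noteq> 0. J a t) = 0"
  shows "\<exists>k. locally_finite_fun k \<and> (\<forall>\<gamma>\<in>\<Gamma>. \<forall>t. J \<gamma> t = k t - k (t - \<gamma>))"
proof -
  have comm: "J \<gamma> t - J \<gamma> (t - \<delta>) = J \<delta> t - J \<delta> (t - \<gamma>)" if "\<gamma> \<in> \<Gamma>" "\<delta> \<in> \<Gamma>" for \<gamma> \<delta> t
    using cocycle[OF that, of t] cocycle[OF that(2,1), of t] by (simp add: add.commute)
  have per: "J \<gamma> (t - b) = J \<gamma> t" if "\<gamma> \<in> \<Gamma>" for \<gamma> t
    using comm[OF that \<Gamma>(2), of t] Jb by simp
  have ch: "charge (J a) t = charge (J a) (t - \<gamma>)" if "\<gamma> \<in> \<Gamma>" for \<gamma> t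
    using J[OF \<Gamma>(1)] per[OF \<Gamma>(1)] J[OF that] per[OF that] comm[OF \<Gamma>(1) that]
    by (rule charge_translate_eq)
  have const: "charge (J a) t = charge (J a) 0" if "J a t \<noteq> 0" for t
    using ch[OF supp[OF \<Gamma>(1) that], of t] by simp
  have "charge (J a) t = 0" if "J a t \<noteq> 0" for t
    using charge_eq_0[OF J[OF \<Gamma>(1)] per[OF \<Gamma>(1)] const total that] const[OF that] by simp
  from periodic_primitive[OF J[OF \<Gamma>(1)] per[OF \<Gamma>(1)] this]
  obtain k where k: "locally_finite_fun k" "\<And>t. k (t - b) = k t" "\<And>t. k t - k (t - a) = J a t"
    by blast
  have "J \<gamma> t = k t - k (t - \<gamma>)" if g: "\<gamma> \<in> \<Gamma>" for \<gamma> t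
  proof -
    define D where "D t = J \<gamma> t - (k t - k (t - \<gamma>))" for t
    have "D t = 0"
    proof (rule invariant_eq_0)
      show "locally_finite_fun D"
        unfolding D_def
        by (intro locally_finite_fun_diff locally_finite_fun_translate J g k)
      show "D (t - b) = D t" for t
        using per[OF g, of t] k(2)[of t] k(2)[of "t - \<gamma>"] by (simp add: D_def algebra_simps)
      show "D (t - a) = D t" for t
        using comm[OF g \<Gamma>(1), of t] k(3)[of t] k(3)[of "t - \<gamma>"] by (simp add: D_def algebra_simps)
    qed
    then show ?thesis by (simp add: D_def)
  qed
  with k(1) show ?thesis by blast
qed

end

section \<open>The split line and the jumps of continuous functions\<close>

text \<open>
  The points near \<open>t\<^sub>-\<close> are those slightly to its left, the points near \<open>t\<^sub>+\<close> those slightly to its right.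
  With this relation the topology can be described through \<^const>\<open>split_proj\<close> and the metric of the line.
\<close>
definition same_side :: "split_point \<Rightarrow> split_point \<Rightarrow> bool" where
  "same_side x y \<longleftrightarrow>
     (\<forall>t. x = Lower t \<longrightarrow> split_proj y < t \<or> y = x) \<and> (\<forall>t. x = Upper t \<longrightarrow> t < split_proj y \<or> y = x)"

lemma same_side_simps [simp]:
  "same_side (Single p) y"
  "same_side (Lower t) y \<longleftrightarrow> split_proj y < t \<or> y = Lower t"
  "same_side (Upper t) y \<longleftrightarrow> t < split_proj y \<or> y = Upper t"
  "same_side x x"
  by (auto simp: same_side_def)

lemma split_line_simps [simp]:
  "Single p \<in> split_line \<Gamma> \<longleftrightarrow> p \<notin> \<Gamma>"
  "Lower p \<in> split_line \<Gamma> \<longleftrightarrow> p \<in> \<Gamma>"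
  "Upper p \<in> split_line \<Gamma> \<longleftrightarrow> p \<in> \<Gamma>"
  by (auto simp: split_line_def)

lemma topspace_split_topology [simp]: "topspace (split_topology \<Gamma>) = split_line \<Gamma>"
  unfolding split_topology_def topology_generated_by_topspace by auto

lemma openin_split_rays:
  assumes "a \<in> split_line \<Gamma>"
  shows "openin (split_topology \<Gamma>) {x \<in> split_line \<Gamma>. split_less a x}"
    "openin (split_topology \<Gamma>) {x \<in> split_line \<Gamma>. split_less x a}"
  unfolding split_topology_def by (rule topology_generated_by_Basis; use assms in auto)+

lemma openin_proj_greater: "openin (split_topology \<Gamma>) {x \<in> split_line \<Gamma>. r < split_proj x}"
proof (cases "r \<in> \<Gamma>")
  case True
  then show ?thesis using openin_split_rays(1)[of "Upper r" \<Gamma>] by (simp add: split_less_def)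
next
  case False
  then show ?thesis using openin_split_rays(1)[of "Single r" \<Gamma>] by (simp add: split_less_def)
qed

lemma openin_proj_less: "openin (split_topology \<Gamma>) {x \<in> split_line \<Gamma>. split_proj x < r}"
proof (cases "r \<in> \<Gamma>")
  case True
  then show ?thesis using openin_split_rays(2)[of "Lower r" \<Gamma>] by (simp add: split_less_def)
next
  case False
  then show ?thesis using openin_split_rays(2)[of "Single r" \<Gamma>] by (simp add: split_less_def)
qed

lemma openin_same_side:
  assumes "x \<in> split_line \<Gamma>"
  shows "openin (split_topology \<Gamma>) {y \<in> split_line \<Gamma>. same_side x y}"
proof (cases x)
  case (Single p)
  then show ?thesis using openin_topspace[of "split_topology \<Gamma>"] by simp
next
  case (Lower t)
  then show ?thesis using openin_split_rays(2)[of "Upper t" \<Gamma>] assms by (simp add: split_less_def)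
next
  case (Upper t)
  then show ?thesis using openin_split_rays(1)[of "Lower t" \<Gamma>] assms by (simp add: split_less_def)
qed

text \<open>
  The rays with a boundary point \<open>t\<^sub>-\<close> or \<open>t\<^sub>+\<close> are either preimages of open rays of the line or such
  preimages together with the one point \<open>t\<^sub>-\<close> or \<open>t\<^sub>+\<close>. Intersections of them give the stated neighbourhoods.
\<close>
lemma openin_split_topology_iff:
  "openin (split_topology \<Gamma>) W \<longleftrightarrow> W \<subseteq> split_line \<Gamma> \<and>
     (\<forall>x\<in>W. \<exists>e>0. \<forall>y\<in>split_line \<Gamma>. \<bar>split_proj y - split_proj x\<bar> < e \<and> same_side x y \<longrightarrow> y \<in> W)"
    (is "_ \<longleftrightarrow> _ \<and> ?nbhd W")
proof
  assume open_W: "openin (split_topology \<Gamma>) W"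
  then have "?nbhd W"
    unfolding split_topology_def openin_topology_generated_by_iff
  proof (induction rule: generate_topology_on.induct)
    case (Int U V)
    show ?case
    proof
      fix x assume "x \<in> U \<inter> V"
      then have "x \<in> U" "x \<in> V" by simp_all
      from Int.IH(1)[rule_format, OF this(1)] Int.IH(2)[rule_format, OF this(2)] obtain d e where
        "d > 0" "\<forall>y\<in>split_line \<Gamma>. \<bar>split_proj y - split_proj x\<bar> < d \<and> same_side x y \<longrightarrow> y \<in> U"
        "e > 0" "\<forall>y\<in>split_line \<Gamma>. \<bar>split_proj y - split_proj x\<bar> < e \<and> same_side x y \<longrightarrow> y \<in> V"
        by blast
      then show "\<exists>e>0. \<forall>y\<in>split_line \<Gamma>. \<bar>split_proj y - split_proj x\<bar> < e \<and> same_side x y \<longrightarrow> y \<in> U \<inter> V"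
        by (intro exI[of _ "min d e"]) simp
    qed
  next
    case (UN K)
    show ?case
    proof
      fix x assume "x \<in> \<Union>K"
      then obtain U where U: "U \<in> K" "x \<in> U" by blast
      from UN.IH[rule_format, OF this] obtain e where
        "e > 0" "\<forall>y\<in>split_line \<Gamma>. \<bar>split_proj y - split_proj x\<bar> < e \<and> same_side x y \<longrightarrow> y \<in> U"
        by blast
      with U(1) show "\<exists>e>0. \<forall>y\<in>split_line \<Gamma>. \<bar>split_proj y - split_proj x\<bar> < e \<and> same_side x y \<longrightarrow> y \<in> \<Union>K"
        by blast
    qed
  next
    case (Basis s)
    then consider "s = split_line \<Gamma>" | a where "a \<in> split_line \<Gamma>" "s = {x \<in> split_line \<Gamma>. split_less a x}"
      | a where "a \<in> split_line \<Gamma>" "s = {x \<in> split_line \<Gamma>. split_less x a}"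
      by auto
    then show ?case
    proof cases
      case 1
      then show ?thesis by (auto intro: exI[of _ 1])
    next
      case 2
      show ?thesis
      proof
        fix x assume x: "x \<in> s"
        show "\<exists>e>0. \<forall>y\<in>split_line \<Gamma>. \<bar>split_proj y - split_proj x\<bar> < e \<and> same_side x y \<longrightarrow> y \<in> s"
        proof (cases "split_proj a < split_proj x")
          case True
          then show ?thesis using 2
            by (intro exI[of _ "split_proj x - split_proj a"]) (auto simp: split_less_def)
        next
          case False
          with x 2 obtain t where "a = Lower t" "x = Upper t" by (auto simp: split_less_def)
          then show ?thesis using 2 by (intro exI[of _ 1]) (auto simp: split_less_def)
        qed
      qed
    next
      case 3
      show ?thesis
      proof
        fix x assume x: "x \<in> s"
        show "\<exists>e>0. \<forall>y\<in>split_line \<Gamma>. \<bar>split_proj y - split_proj x\<bar> < e \<and> same_side x y \<longrightarrow> y \<in> s"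
        proof (cases "split_proj x < split_proj a")
          case True
          then show ?thesis using 3
            by (intro exI[of _ "split_proj a - split_proj x"]) (auto simp: split_less_def)
        next
          case False
          with x 3 obtain t where "x = Lower t" "a = Upper t" by (auto simp: split_less_def)
          then show ?thesis using 3 by (intro exI[of _ 1]) (auto simp: split_less_def)
        qed
      qed
    qed
  qed simp
  then show "W \<subseteq> split_line \<Gamma> \<and> ?nbhd W" using openin_subset[OF open_W] by simp
next
  assume W: "W \<subseteq> split_line \<Gamma> \<and> ?nbhd W"
  show "openin (split_topology \<Gamma>) W"
  proof (subst openin_subopen, intro ballI)
    fix x assume x: "x \<in> W"
    with W obtain e where e: "e > 0"
      "\<And>y. y \<in> split_line \<Gamma> \<Longrightarrow> \<bar>split_proj y - split_proj x\<bar> < e \<and> same_side x y \<Longrightarrow> y \<in> W" by blast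
    define N where "N = {y \<in> split_line \<Gamma>. split_proj x - e < split_proj y}
      \<inter> {y \<in> split_line \<Gamma>. split_proj y < split_proj x + e} \<inter> {y \<in> split_line \<Gamma>. same_side x y}"
    have "openin (split_topology \<Gamma>) N"
      unfolding N_def using x W
      by (intro openin_Int openin_proj_greater openin_proj_less openin_same_side) auto
    moreover have "x \<in> N" using x W e(1) by (auto simp: N_def)
    moreover have "N \<subseteq> W"
    proof
      fix y assume "y \<in> N"
      then have y: "y \<in> split_line \<Gamma>" "split_proj x - e < split_proj y" "split_proj y < split_proj x + e" "same_side x y"
        by (simp_all add: N_def)
      then have "\<bar>split_proj y - split_proj x\<bar> < e" by linarith
      with y show "y \<in> W" using e(2) by blast
    qed
    ultimately show "\<exists>T. openin (split_topology \<Gamma>) T \<and> x \<in> T \<and> T \<subseteq> W" by blast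
  qed
qed

abbreviation continuous_split :: "real set \<Rightarrow> (split_point \<Rightarrow> int) \<Rightarrow> bool" where
  "continuous_split \<Gamma> \<equiv> continuous_map (split_topology \<Gamma>) (discrete_topology UNIV)"

lemma continuous_split_iff:
  "continuous_split \<Gamma> f \<longleftrightarrow> (\<forall>x\<in>split_line \<Gamma>. \<exists>e>0. \<forall>y\<in>split_line \<Gamma>.
      \<bar>split_proj y - split_proj x\<bar> < e \<and> same_side x y \<longrightarrow> f y = f x)"
proof
  assume f: "continuous_split \<Gamma> f"
  show "\<forall>x\<in>split_line \<Gamma>. \<exists>e>0. \<forall>y\<in>split_line \<Gamma>.
      \<bar>split_proj y - split_proj x\<bar> < e \<and> same_side x y \<longrightarrow> f y = f x"
  proof
    fix x assume x: "x \<in> split_line \<Gamma>"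
    from f have "\<forall>U. openin (split_topology \<Gamma>) {y \<in> split_line \<Gamma>. f y \<in> U}"
      by (simp add: continuous_map_def)
    then have "openin (split_topology \<Gamma>) {y \<in> split_line \<Gamma>. f y \<in> {f x}}" ..
    then have "\<forall>z\<in>{y \<in> split_line \<Gamma>. f y \<in> {f x}}. \<exists>e>0. \<forall>y\<in>split_line \<Gamma>.
        \<bar>split_proj y - split_proj z\<bar> < e \<and> same_side z y \<longrightarrow> y \<in> {y \<in> split_line \<Gamma>. f y \<in> {f x}}"
      unfolding openin_split_topology_iff by (rule conjunct2)
    moreover have "x \<in> {y \<in> split_line \<Gamma>. f y \<in> {f x}}" using x by simp
    ultimately have "\<exists>e>0. \<forall>y\<in>split_line \<Gamma>.
        \<bar>split_proj y - split_proj x\<bar> < e \<and> same_side x y \<longrightarrow> y \<in> {y \<in> split_line \<Gamma>. f y \<in> {f x}}"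
      by (rule bspec)
    then show "\<exists>e>0. \<forall>y\<in>split_line \<Gamma>. \<bar>split_proj y - split_proj x\<bar> < e \<and> same_side x y \<longrightarrow> f y = f x"
      by simp
  qed
next
  assume f: "\<forall>x\<in>split_line \<Gamma>. \<exists>e>0. \<forall>y\<in>split_line \<Gamma>.
      \<bar>split_proj y - split_proj x\<bar> < e \<and> same_side x y \<longrightarrow> f y = f x"
  have "openin (split_topology \<Gamma>) {y \<in> split_line \<Gamma>. f y \<in> U}" for U
    unfolding openin_split_topology_iff
  proof (intro conjI ballI)
    fix x assume x: "x \<in> {y \<in> split_line \<Gamma>. f y \<in> U}"
    then have "x \<in> split_line \<Gamma>" "f x \<in> U" by simp_all
    from bspec[OF f this(1)] obtain e where "e > 0" "\<forall>y\<in>split_line \<Gamma>.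
      \<bar>split_proj y - split_proj x\<bar> < e \<and> same_side x y \<longrightarrow> f y = f x" by (elim exE conjE)
    with \<open>f x \<in> U\<close> show "\<exists>e>0. \<forall>y\<in>split_line \<Gamma>. \<bar>split_proj y - split_proj x\<bar> < e \<and> same_side x y
        \<longrightarrow> y \<in> {y \<in> split_line \<Gamma>. f y \<in> U}"
      by (intro exI[of _ e]) simp
  qed simp
  then show "continuous_split \<Gamma> f" by (simp add: continuous_map_def)
qed

lemma continuous_splitE:
  assumes "continuous_split \<Gamma> f" "x \<in> split_line \<Gamma>"
  obtains e where "e > 0" "\<And>y. y \<in> split_line \<Gamma> \<Longrightarrow> \<bar>split_proj y - split_proj x\<bar> < e \<Longrightarrow> same_side x y \<Longrightarrow> f y = f x"
proof -
  from assms(1)[unfolded continuous_split_iff] assms(2)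
  have "\<exists>e>0. \<forall>y\<in>split_line \<Gamma>. \<bar>split_proj y - split_proj x\<bar> < e \<and> same_side x y \<longrightarrow> f y = f x"
    by (rule bspec)
  then show ?thesis using that by blast
qed

text \<open>Functions into a discrete space may be combined by an arbitrary operation.\<close>
lemma continuous_split_combine:
  assumes "continuous_split \<Gamma> f" "continuous_split \<Gamma> g"
  shows "continuous_split \<Gamma> (\<lambda>x. F (f x) (g x))"
  unfolding continuous_split_iff
proof
  fix x assume x: "x \<in> split_line \<Gamma>"
  obtain d where "d > 0"
    "\<And>y. y \<in> split_line \<Gamma> \<Longrightarrow> \<bar>split_proj y - split_proj x\<bar> < d \<Longrightarrow> same_side x y \<Longrightarrow> f y = f x"
    using continuous_splitE[OF assms(1) x] by blast
  moreover obtain e where "e > 0"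
    "\<And>y. y \<in> split_line \<Gamma> \<Longrightarrow> \<bar>split_proj y - split_proj x\<bar> < e \<Longrightarrow> same_side x y \<Longrightarrow> g y = g x"
    using continuous_splitE[OF assms(2) x] by blast
  ultimately show "\<exists>e>0. \<forall>y\<in>split_line \<Gamma>. \<bar>split_proj y - split_proj x\<bar> < e \<and> same_side x y
      \<longrightarrow> F (f y) (g y) = F (f x) (g x)"
    by (intro exI[of _ "min d e"]) simp
qed

lemma split_proj_translate [simp]: "split_proj (split_translate s x) = split_proj x + s"
  by (cases x) auto

lemma split_translate_translate [simp]: "split_translate s (split_translate r x) = split_translate (r + s) x"
  by (cases x) auto

lemma same_side_translate: "same_side x y \<Longrightarrow> same_side (split_translate s x) (split_translate s y)"
  by (cases x; cases y) auto

locale real_subgroup =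
  fixes \<Gamma> :: "real set"
  assumes zero_mem [simp]: "0 \<in> \<Gamma>" and diff_mem: "x \<in> \<Gamma> \<Longrightarrow> y \<in> \<Gamma> \<Longrightarrow> x - y \<in> \<Gamma>"
begin

lemma uminus_mem: "x \<in> \<Gamma> \<Longrightarrow> - x \<in> \<Gamma>"
  using diff_mem[of 0 x] by simp

lemma add_mem: "x \<in> \<Gamma> \<Longrightarrow> y \<in> \<Gamma> \<Longrightarrow> x + y \<in> \<Gamma>"
  using diff_mem[of x "- y"] uminus_mem[of y] by simp

lemma add_mem_iff: "s \<in> \<Gamma> \<Longrightarrow> x + s \<in> \<Gamma> \<longleftrightarrow> x \<in> \<Gamma>"
  using add_mem[of x s] diff_mem[of "x + s" s] by auto

lemma diff_mem_iff: "s \<in> \<Gamma> \<Longrightarrow> x - s \<in> \<Gamma> \<longleftrightarrow> x \<in> \<Gamma>"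
  using add_mem_iff[of s "x - s"] by simp

lemma split_translate_mem:
  "s \<in> \<Gamma> \<Longrightarrow> split_translate s x \<in> split_line \<Gamma> \<longleftrightarrow> x \<in> split_line \<Gamma>"
  by (cases x) (simp_all add: add_mem_iff)

lemma continuous_split_translate:
  assumes f: "continuous_split \<Gamma> f" and s: "s \<in> \<Gamma>"
  shows "continuous_split \<Gamma> (\<lambda>x. f (split_translate s x))"
  unfolding continuous_split_iff
proof
  fix x assume "x \<in> split_line \<Gamma>"
  then have "split_translate s x \<in> split_line \<Gamma>" using s by (simp add: split_translate_mem)
  from continuous_splitE[OF f this] obtain e where e: "e > 0" "\<And>y. y \<in> split_line \<Gamma> \<Longrightarrow>
      \<bar>split_proj y - split_proj (split_translate s x)\<bar> < e \<Longrightarrow> same_side (split_translate s x) y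
      \<Longrightarrow> f y = f (split_translate s x)" by blast
  show "\<exists>e>0. \<forall>y\<in>split_line \<Gamma>. \<bar>split_proj y - split_proj x\<bar> < e \<and> same_side x y
      \<longrightarrow> f (split_translate s y) = f (split_translate s x)"
    using e(1) s by (intro exI[of _ e] conjI ballI impI e(2)) (auto simp: split_translate_mem same_side_translate)
qed

end

definition jump :: "real set \<Rightarrow> (split_point \<Rightarrow> int) \<Rightarrow> real \<Rightarrow> int" where
  "jump \<Gamma> f t = (if t \<in> \<Gamma> then f (Upper t) - f (Lower t) else 0)"

text \<open>
  Next to \<open>p\<close>, on either side, \<open>f\<close> is constant on an interval of the split line that contains both copies of
  each of its doubled points.
\<close>
lemma jump_isolated:
  assumes f: "continuous_split \<Gamma> f"
  shows "\<exists>e>0. \<forall>t. \<bar>t - p\<bar> < e \<and> t \<noteq> p \<longrightarrow> jump \<Gamma> f t = 0"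
proof (cases "p \<in> \<Gamma>")
  case True
  obtain d where d: "d > 0"
    "\<And>y. y \<in> split_line \<Gamma> \<Longrightarrow> \<bar>split_proj y - p\<bar> < d \<Longrightarrow> same_side (Lower p) y \<Longrightarrow> f y = f (Lower p)"
    using True continuous_splitE[OF f, of "Lower p"] by auto
  obtain e where e: "e > 0"
    "\<And>y. y \<in> split_line \<Gamma> \<Longrightarrow> \<bar>split_proj y - p\<bar> < e \<Longrightarrow> same_side (Upper p) y \<Longrightarrow> f y = f (Upper p)"
    using True continuous_splitE[OF f, of "Upper p"] by auto
  have "jump \<Gamma> f t = 0" if t: "\<bar>t - p\<bar> < min d e" "t \<noteq> p" for t
  proof (cases "t < p")
    case True
    then show ?thesis
      using d(2)[of "Lower t"] d(2)[of "Upper t"] t by (simp add: jump_def)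
  next
    case False
    then show ?thesis
      using e(2)[of "Lower t"] e(2)[of "Upper t"] t by (simp add: jump_def)
  qed
  then show ?thesis using d(1) e(1) by (intro exI[of _ "min d e"]) auto
next
  case False
  obtain e where
    e: "e > 0" "\<And>y. y \<in> split_line \<Gamma> \<Longrightarrow> \<bar>split_proj y - p\<bar> < e \<Longrightarrow> f y = f (Single p)"
    using False continuous_splitE[OF f, of "Single p"] by auto
  have "jump \<Gamma> f t = 0" if t: "\<bar>t - p\<bar> < e" for t
    using e(2)[of "Lower t"] e(2)[of "Upper t"] t by (auto simp: jump_def)
  then show ?thesis using e(1) by blast
qed

lemma locally_finite_jump:
  assumes f: "continuous_split \<Gamma> f"
  shows "locally_finite_fun (jump \<Gamma> f)"
  unfolding locally_finite_fun_def
proof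
  fix R
  have "finite ({-R..R} \<inter> {t. jump \<Gamma> f t \<noteq> 0})"
  proof (rule finite_not_islimpt_in_compact)
    fix p
    show "\<not> p islimpt {t. jump \<Gamma> f t \<noteq> 0}"
      using jump_isolated[OF f, of p] unfolding islimpt_approachable dist_real_def by blast
  qed simp
  then show "finite {t. \<bar>t\<bar> \<le> R \<and> jump \<Gamma> f t \<noteq> 0}"
    by (rule rev_finite_subset) auto
qed

text \<open>Without jumps \<open>f\<close> descends to a locally constant function on the line, which is connected.\<close>
lemma constant_if_no_jumps:
  assumes f: "continuous_split \<Gamma> f" and no_jump: "\<And>t. jump \<Gamma> f t = 0"
    and "x \<in> split_line \<Gamma>" "y \<in> split_line \<Gamma>"
  shows "f x = f y"
proof -
  define g where "g p = f (if p \<in> \<Gamma> then Upper p else Single p)" for p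
  have fg: "f x = g (split_proj x)" if "x \<in> split_line \<Gamma>" for x
    using that no_jump[of "split_proj x"] by (cases x) (auto simp: g_def jump_def)
  have loc: "\<exists>e>0. \<forall>r. \<bar>r - p\<bar> < e \<longrightarrow> g r = g p" for p
  proof (cases "p \<in> \<Gamma>")
    case True
    obtain d where d: "d > 0"
      "\<And>y. y \<in> split_line \<Gamma> \<Longrightarrow> \<bar>split_proj y - p\<bar> < d \<Longrightarrow> same_side (Lower p) y \<Longrightarrow> f y = f (Lower p)"
      using True continuous_splitE[OF f, of "Lower p"] by auto
    obtain e where e: "e > 0"
      "\<And>y. y \<in> split_line \<Gamma> \<Longrightarrow> \<bar>split_proj y - p\<bar> < e \<Longrightarrow> same_side (Upper p) y \<Longrightarrow> f y = f (Upper p)"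
      using True continuous_splitE[OF f, of "Upper p"] by auto
    have "g r = g p" if r: "\<bar>r - p\<bar> < min d e" for r
    proof -
      define y where "y = (if r \<in> \<Gamma> then Upper r else Single r)"
      have y: "y \<in> split_line \<Gamma>" "split_proj y = r" by (auto simp: y_def)
      have gp: "g p = f (Lower p)" "g p = f (Upper p)" "g r = f y"
        using fg[of "Lower p"] fg[of "Upper p"] fg[OF y(1)] y(2) True by simp_all
      consider "r < p" | "r = p" | "p < r" by linarith
      then show ?thesis
      proof cases
        case 1
        then show ?thesis using d(2)[OF y(1)] y(2) r gp by simp
      next
        case 3
        then show ?thesis using e(2)[OF y(1)] y(2) r gp by simp
      qed simp
    qed
    moreover have "min d e > 0" using d(1) e(1) by simp
    ultimately show ?thesis by blast
  next
    case False
    obtain e where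
      e: "e > 0" "\<And>y. y \<in> split_line \<Gamma> \<Longrightarrow> \<bar>split_proj y - p\<bar> < e \<Longrightarrow> f y = f (Single p)"
      using False continuous_splitE[OF f, of "Single p"] by auto
    have "g r = g p" if r: "\<bar>r - p\<bar> < e" for r
    proof -
      have "f (if r \<in> \<Gamma> then Upper r else Single r) = f (Single p)"
        by (rule e(2)) (use r in simp_all)
      then show ?thesis using False by (simp add: g_def)
    qed
    then show ?thesis using e(1) by blast
  qed
  have op: "open (g -` C)" for C
    unfolding open_dist dist_real_def
  proof
    fix p assume "p \<in> g -` C"
    then have gp: "g p \<in> C" by (simp only: vimage_eq)
    obtain e where e: "e > 0" "\<forall>r. \<bar>r - p\<bar> < e \<longrightarrow> g r = g p" using loc[of p] by blast
    have "r \<in> g -` C" if "\<bar>r - p\<bar> < e" for r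
    proof -
      from e(2) that have "g r = g p" by blast
      with gp show ?thesis by (simp only: vimage_eq)
    qed
    then show "\<exists>e>0. \<forall>r. \<bar>r - p\<bar> < e \<longrightarrow> r \<in> g -` C" using e(1) by blast
  qed
  have "g p = g r" for p r
  proof -
    have "closed (g -` {g p})" unfolding closed_def vimage_Compl[symmetric] by (rule op)
    with op[of "{g p}"] have "g -` {g p} = {} \<or> g -` {g p} = UNIV"
      by (intro iffD1[OF clopen] conjI)
    then have "g -` {g p} = UNIV" by fastforce
    then have "r \<in> g -` {g p}" by (simp only: UNIV_I)
    then show ?thesis by (simp only: vimage_singleton_eq)
  qed
  then have "g (split_proj x) = g (split_proj y)" .
  then show ?thesis unfolding fg[OF assms(3)] fg[OF assms(4)] .
qed

text \<open>The points \<open>t\<close> of the line with \<open>t\<^sub>+ \<le> x\<close>, that is, those at which a function jumps before reaching \<open>x\<close>.\<close>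
definition jumps_below :: "split_point \<Rightarrow> real set" where
  "jumps_below x = {t. t < split_proj x \<or> x = Upper t}"

text \<open>
  The function with jumps \<open>k\<close>, normalised near the origin: jumps between the origin and \<open>x\<close> are added when
  \<open>x\<close> lies to the right and subtracted when it lies to the left. Summing over all jumps below \<open>x\<close> instead
  would give an infinite sum.
\<close>
definition step_function :: "real set \<Rightarrow> (real \<Rightarrow> int) \<Rightarrow> split_point \<Rightarrow> int" where
  "step_function \<Gamma> k x =
     (\<Sum>t | t \<in> \<Gamma> \<and> k t \<noteq> 0 \<and> 0 < t \<and> t \<in> jumps_below x. k t)
   - (\<Sum>t | t \<in> \<Gamma> \<and> k t \<noteq> 0 \<and> t \<le> 0 \<and> t \<notin> jumps_below x. k t)"

lemma step_function_diff:
  assumes k: "locally_finite_fun k" and sub: "jumps_below x \<subseteq> jumps_below y"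
  shows "step_function \<Gamma> k y - step_function \<Gamma> k x
    = (\<Sum>t | t \<in> \<Gamma> \<and> k t \<noteq> 0 \<and> t \<in> jumps_below y - jumps_below x. k t)"
proof -
  define S where "S = {t. t \<in> \<Gamma> \<and> k t \<noteq> 0}"
  have S1: "finite (S \<inter> {0<..} \<inter> jumps_below z)" for z
    by (rule finite_subset[OF _ locally_finite_funD[OF k, of "\<bar>split_proj z\<bar>"]])
       (auto simp: S_def jumps_below_def)
  have S2: "finite (S \<inter> {..0} - jumps_below z)" for z
    by (rule finite_subset[OF _ locally_finite_funD[OF k, of "\<bar>split_proj z\<bar>"]])
       (auto simp: S_def jumps_below_def)
  have e: "step_function \<Gamma> k z = sum k (S \<inter> {0<..} \<inter> jumps_below z) - sum k (S \<inter> {..0} - jumps_below z)" for z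
    unfolding step_function_def S_def by (intro arg_cong2[of _ _ _ _ "(-)"] sum.cong) auto
  let ?D = "jumps_below y - jumps_below x"
  have D: "finite (S \<inter> {0<..} \<inter> ?D)" "finite (S \<inter> {..0} \<inter> ?D)"
    by (rule finite_subset[OF _ S1[of y]], blast) (rule finite_subset[OF _ S2[of x]], blast)
  have "S \<inter> {0<..} \<inter> jumps_below y = (S \<inter> {0<..} \<inter> jumps_below x) \<union> (S \<inter> {0<..} \<inter> ?D)"
    using sub by blast
  then have 1: "sum k (S \<inter> {0<..} \<inter> jumps_below y) =
      sum k (S \<inter> {0<..} \<inter> jumps_below x) + sum k (S \<inter> {0<..} \<inter> ?D)"
    using sum.union_disjoint[OF S1[of x] D(1), of k] by fastforce
  have "S \<inter> {..0} - jumps_below x = (S \<inter> {..0} - jumps_below y) \<union> (S \<inter> {..0} \<inter> ?D)"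
    using sub by blast
  then have 2: "sum k (S \<inter> {..0} - jumps_below x) =
      sum k (S \<inter> {..0} - jumps_below y) + sum k (S \<inter> {..0} \<inter> ?D)"
    using sum.union_disjoint[OF S2[of y] D(2), of k] by fastforce
  have "S \<inter> ?D = (S \<inter> {0<..} \<inter> ?D) \<union> (S \<inter> {..0} \<inter> ?D)" by auto
  moreover have "(S \<inter> {0<..} \<inter> ?D) \<inter> (S \<inter> {..0} \<inter> ?D) = {}" by auto
  ultimately have 3: "sum k (S \<inter> ?D) = sum k (S \<inter> {0<..} \<inter> ?D) + sum k (S \<inter> {..0} \<inter> ?D)"
    using sum.union_disjoint[OF D, of k] by simp
  have "{t. t \<in> \<Gamma> \<and> k t \<noteq> 0 \<and> t \<in> jumps_below y - jumps_below x} = S \<inter> (jumps_below y - jumps_below x)"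
    by (auto simp: S_def)
  with 1 2 3 show ?thesis by (simp add: e)
qed

lemma jump_step_function:
  assumes k: "locally_finite_fun k"
  shows "jump \<Gamma> (step_function \<Gamma> k) t = (if t \<in> \<Gamma> then k t else 0)"
proof (cases "t \<in> \<Gamma>")
  case True
  have *: "{s. s \<in> \<Gamma> \<and> k s \<noteq> 0 \<and> s \<in> jumps_below (Upper t) - jumps_below (Lower t)} = (if k t = 0 then {} else {t})"
    using True by (auto simp: jumps_below_def)
  have "jumps_below (Lower t) \<subseteq> jumps_below (Upper t)" by (auto simp: jumps_below_def)
  from step_function_diff[OF k this, of \<Gamma>]
  have "step_function \<Gamma> k (Upper t) - step_function \<Gamma> k (Lower t) = k t"
    unfolding * by simp
  with True show ?thesis by (simp add: jump_def)
qed (simp add: jump_def)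

lemma continuous_step_function:
  assumes k: "locally_finite_fun k"
  shows "continuous_split \<Gamma> (step_function \<Gamma> k)"
  unfolding continuous_split_iff
proof
  fix x assume x: "x \<in> split_line \<Gamma>"
  define p where "p = split_proj x"
  have "finite ({t. \<bar>t\<bar> \<le> \<bar>p\<bar> + 1 \<and> k t \<noteq> 0} - {p})" (is "finite ?A") using locally_finite_funD[OF k] by simp
  from finite_set_avoid[OF this, of p]
  obtain d where d: "d > 0" "\<And>t. t \<in> ?A \<Longrightarrow> t \<noteq> p \<Longrightarrow> d \<le> \<bar>p - t\<bar>"
    unfolding dist_real_def by blast
  define e where "e = min d 1"
  have e: "\<bar>t - p\<bar> \<ge> e" if "k t \<noteq> 0" "t \<noteq> p" for t
  proof (cases "\<bar>t\<bar> \<le> \<bar>p\<bar> + 1")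
    case True
    with that d(2)[of t] show ?thesis by (simp add: e_def abs_minus_commute)
  next
    case False
    then show ?thesis by (simp add: e_def)
  qed
  have "step_function \<Gamma> k y = step_function \<Gamma> k x"
    if y: "y \<in> split_line \<Gamma>" "\<bar>split_proj y - p\<bar> < e" "same_side x y" for y
  proof -
    have "t \<in> jumps_below y \<longleftrightarrow> t \<in> jumps_below x" if t: "t \<in> \<Gamma>" "k t \<noteq> 0" for t
    proof (cases "t = p")
      case True
      then show ?thesis using x t y(3) unfolding p_def by (cases x) (auto simp: jumps_below_def)
    next
      case False
      then consider "t < p" "t < split_proj y" | "p < t" "split_proj y < t"
        using e[OF t(2) False] y(2) by linarith
      then show ?thesis
      proof cases
        case 1
        then show ?thesis by (simp add: p_def jumps_below_def)
      next
        case 2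
        then have "x \<noteq> Upper t" "y \<noteq> Upper t" by (auto simp: p_def)
        with 2 show ?thesis by (simp add: p_def jumps_below_def)
      qed
    qed
    then show ?thesis unfolding step_function_def
      by (intro arg_cong2[of _ _ _ _ "(-)"] sum.cong refl) blast+
  qed
  moreover have "e > 0" using d(1) by (simp add: e_def)
  ultimately show "\<exists>e>0. \<forall>y\<in>split_line \<Gamma>. \<bar>split_proj y - split_proj x\<bar> < e \<and> same_side x y
      \<longrightarrow> step_function \<Gamma> k y = step_function \<Gamma> k x"
    unfolding p_def by blast
qed

section \<open>Cocycles of the translation action\<close>

lemma jump_diff: "jump \<Gamma> (\<lambda>x. f x - g x) t = jump \<Gamma> f t - jump \<Gamma> g t"
  by (simp add: jump_def)

context real_subgroup begin

lemma jump_translate: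
  "s \<in> \<Gamma> \<Longrightarrow> jump \<Gamma> (\<lambda>x. f (split_translate (- s) x)) t = jump \<Gamma> f (t - s)"
  by (simp add: jump_def diff_mem_iff)

lemma continuous_coboundary:
  assumes "continuous_split \<Gamma> h" "\<gamma> \<in> \<Gamma>"
  shows "continuous_split \<Gamma> (\<lambda>x. h x - h (split_translate (- \<gamma>) x))"
  using continuous_split_combine[OF assms(1) continuous_split_translate[OF assms(1) uminus_mem[OF assms(2)]], of "(-)"] .

lemma jump_coboundary:
  assumes "\<gamma> \<in> \<Gamma>"
  shows "jump \<Gamma> (\<lambda>x. h x - h (split_translate (- \<gamma>) x)) t = jump \<Gamma> h t - jump \<Gamma> h (t - \<gamma>)"
  using jump_translate[OF assms, of h t] by (simp add: jump_diff)

text \<open>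
  Two coboundaries are removed in turn: that of a function \<open>h1\<close> solving the equation for the jumps along
  \<open>b\<close>, and that of a function \<open>h2\<close> whose jumps are the primitive of the remaining jump cocycle.
\<close>
lemma cocycle_cohomologous_to_hom:
  assumes ab: "a \<in> \<Gamma>" "b \<in> \<Gamma>" "b > 0" "incommensurable a b"
    and cont: "\<And>\<gamma>. \<gamma> \<in> \<Gamma> \<Longrightarrow> continuous_split \<Gamma> (c \<gamma>)"
    and cocycle: "\<And>\<gamma> \<delta> x. \<gamma> \<in> \<Gamma> \<Longrightarrow> \<delta> \<in> \<Gamma> \<Longrightarrow> x \<in> split_line \<Gamma> \<Longrightarrow>
      c (\<gamma> + \<delta>) x = c \<gamma> x + c \<delta> (split_translate (- \<gamma>) x)"
  shows "\<exists>h \<phi>. continuous_split \<Gamma> h \<and>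
    (\<forall>\<gamma>\<in>\<Gamma>. \<forall>x\<in>split_line \<Gamma>. c \<gamma> x = \<phi> \<gamma> + (h x - h (split_translate (- \<gamma>) x)))"
proof -
  interpret irrational_rotation a b using ab(3,4) by unfold_locales
  obtain k1 where k1: "locally_finite_fun k1" "\<And>t. k1 t - k1 (t - b) = jump \<Gamma> (c b) t"
    using locally_finite_primitive[OF locally_finite_jump[OF cont[OF ab(2)]] ab(3)] by blast
  define h1 where "h1 = step_function \<Gamma> k1"
  have h1: "continuous_split \<Gamma> h1" unfolding h1_def by (rule continuous_step_function[OF k1(1)])
  define c1 where "c1 \<gamma> x = c \<gamma> x - (h1 x - h1 (split_translate (- \<gamma>) x))" for \<gamma> x
  have cont1: "continuous_split \<Gamma> (c1 \<gamma>)" if "\<gamma> \<in> \<Gamma>" for \<gamma>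
    using continuous_split_combine[OF cont[OF that] continuous_coboundary[OF h1 that], of "(-)"]
    unfolding c1_def .
  have cocycle1: "c1 (\<gamma> + \<delta>) x = c1 \<gamma> x + c1 \<delta> (split_translate (- \<gamma>) x)"
    if "\<gamma> \<in> \<Gamma>" "\<delta> \<in> \<Gamma>" "x \<in> split_line \<Gamma>" for \<gamma> \<delta> x
    using cocycle[OF that] by (simp add: c1_def)
  define J where "J \<gamma> = jump \<Gamma> (c1 \<gamma>)" for \<gamma>
  have J_c1: "J \<gamma> t = jump \<Gamma> (c \<gamma>) t - (jump \<Gamma> h1 t - jump \<Gamma> h1 (t - \<gamma>))" if "\<gamma> \<in> \<Gamma>" for \<gamma> t
    using jump_diff[of \<Gamma> "c \<gamma>" "\<lambda>x. h1 x - h1 (split_translate (- \<gamma>) x)" t] jump_coboundary[OF that, of h1 t]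
    unfolding J_def c1_def by simp
  have Jb: "J b t = 0" for t
    using k1(2)[of t] jump_step_function[OF k1(1), of \<Gamma>]
    by (simp add: J_c1[OF ab(2)] h1_def diff_mem_iff ab(2)) (simp add: jump_def)
  have J_lf: "locally_finite_fun (J \<gamma>)" if "\<gamma> \<in> \<Gamma>" for \<gamma>
    unfolding J_def by (rule locally_finite_jump[OF cont1[OF that]])
  have J_cocycle: "J (\<gamma> + \<delta>) t = J \<gamma> t + J \<delta> (t - \<gamma>)" if "\<gamma> \<in> \<Gamma>" "\<delta> \<in> \<Gamma>" for \<gamma> \<delta> t
    using cocycle1[OF that, of "Upper t"] cocycle1[OF that, of "Lower t"]
    by (simp add: J_def jump_def diff_mem_iff that)
  \<comment> \<open>Since \<open>c1 b\<close> is constant, the cocycle identity makes \<open>c1 a\<close> periodic. The sum of its jumps over a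
    period is its increment over that period.\<close>
  have total: "(\<Sum>t | 0 \<le> t \<and> t < b \<and> J a t \<noteq> 0. J a t) = 0"
  proof -
    have const: "c1 b x = c1 b y" if "x \<in> split_line \<Gamma>" "y \<in> split_line \<Gamma>" for x y
      using constant_if_no_jumps[OF cont1[OF ab(2)] _ that] Jb unfolding J_def by blast
    have per: "c1 a (Lower b) = c1 a (Lower 0)"
      using cocycle1[OF ab(1,2), of "Lower b"] cocycle1[OF ab(2,1), of "Lower b"]
        const[of "Lower (b - a)" "Lower b"] ab
      by (simp add: add.commute diff_mem)
    define s where "s = step_function \<Gamma> (J a)"
    have "jump \<Gamma> (\<lambda>x. c1 a x - s x) t = 0" for t
      using jump_step_function[OF J_lf[OF ab(1)], of \<Gamma> t] by (simp add: jump_diff s_def J_def jump_def)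
    moreover have "continuous_split \<Gamma> (\<lambda>x. c1 a x - s x)"
      unfolding s_def using continuous_split_combine[OF cont1[OF ab(1)] continuous_step_function[OF J_lf[OF ab(1)]], of "(-)"] .
    ultimately have "c1 a (Lower b) - s (Lower b) = c1 a (Lower 0) - s (Lower 0)"
      using constant_if_no_jumps[of \<Gamma> "\<lambda>x. c1 a x - s x" "Lower b" "Lower 0"] ab by simp
    then have "s (Lower b) - s (Lower 0) = 0" using per by simp
    moreover have "jumps_below (Lower 0) \<subseteq> jumps_below (Lower b)"
      using ab(3) by (auto simp: jumps_below_def)
    from step_function_diff[OF J_lf[OF ab(1)] this, of \<Gamma>]
    have "s (Lower b) - s (Lower 0)
      = (\<Sum>t | t \<in> \<Gamma> \<and> J a t \<noteq> 0 \<and> t \<in> jumps_below (Lower b) - jumps_below (Lower 0). J a t)"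
      unfolding s_def .
    moreover have "{t. t \<in> \<Gamma> \<and> J a t \<noteq> 0 \<and> t \<in> jumps_below (Lower b) - jumps_below (Lower 0)}
      = {t. 0 \<le> t \<and> t < b \<and> J a t \<noteq> 0}"
      by (auto simp: jumps_below_def J_def jump_def)
    ultimately show ?thesis by simp
  qed
  have "\<exists>k. locally_finite_fun k \<and> (\<forall>\<gamma>\<in>\<Gamma>. \<forall>t. J \<gamma> t = k t - k (t - \<gamma>))"
    by (rule jump_cocycle_is_coboundary[OF ab(1,2) add_mem J_lf _ J_cocycle Jb total])
       (auto simp: J_def jump_def split: if_splits)
  then obtain k where k: "locally_finite_fun k" "\<And>\<gamma> t. \<gamma> \<in> \<Gamma> \<Longrightarrow> J \<gamma> t = k t - k (t - \<gamma>)" by blast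
  define h2 where "h2 = step_function \<Gamma> k"
  have h2: "continuous_split \<Gamma> h2" unfolding h2_def by (rule continuous_step_function[OF k(1)])
  define c2 where "c2 \<gamma> x = c1 \<gamma> x - (h2 x - h2 (split_translate (- \<gamma>) x))" for \<gamma> x
  have const: "c2 \<gamma> x = c2 \<gamma> (Upper 0)" if g: "\<gamma> \<in> \<Gamma>" and x: "x \<in> split_line \<Gamma>" for \<gamma> x
  proof (rule constant_if_no_jumps)
    show "continuous_split \<Gamma> (c2 \<gamma>)"
      using continuous_split_combine[OF cont1[OF g] continuous_coboundary[OF h2 g], of "(-)"]
      unfolding c2_def .
    show "jump \<Gamma> (c2 \<gamma>) t = 0" for t
    proof -
      have "jump \<Gamma> (c2 \<gamma>) t = J \<gamma> t - (jump \<Gamma> h2 t - jump \<Gamma> h2 (t - \<gamma>))"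
        using jump_diff[of \<Gamma> "c1 \<gamma>" "\<lambda>x. h2 x - h2 (split_translate (- \<gamma>) x)" t] jump_coboundary[OF g, of h2 t]
        unfolding J_def c2_def by simp
      also have "\<dots> = 0"
      proof (cases "t \<in> \<Gamma>")
        case True
        then show ?thesis
          using k(2)[OF g, of t] by (simp add: h2_def jump_step_function[OF k(1)] diff_mem_iff g)
      next
        case False
        then show ?thesis by (simp add: J_def jump_def diff_mem_iff g)
      qed
      finally show ?thesis .
    qed
  qed (use x in simp_all)
  have "c \<gamma> x = c2 \<gamma> (Upper 0) + ((h1 x + h2 x) - (h1 (split_translate (- \<gamma>) x) + h2 (split_translate (- \<gamma>) x)))"
    if "\<gamma> \<in> \<Gamma>" "x \<in> split_line \<Gamma>" for \<gamma> x
    using const[OF that] unfolding c2_def[of \<gamma> x] c1_def[of \<gamma> x] by linarith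
  moreover have "continuous_split \<Gamma> (\<lambda>x. h1 x + h2 x)"
    using continuous_split_combine[OF h1 h2, of "(+)"] .
  ultimately show ?thesis
    by (intro exI[of _ "\<lambda>x. h1 x + h2 x"] exI[of _ "\<lambda>\<gamma>. c2 \<gamma> (Upper 0)"]) blast
qed

text \<open>
  The translates of \<open>f\<close> differ from \<open>f\<close> by constants, so the jumps of \<open>f\<close> are invariant under the dense
  group generated by \<open>a\<close> and \<open>b\<close>. Being locally finite, they vanish.
\<close>
lemma constant_coboundary_eq_0:
  assumes ab: "a \<in> \<Gamma>" "b \<in> \<Gamma>" "b > 0" "incommensurable a b"
    and f: "continuous_split \<Gamma> f"
    and \<theta>: "\<And>\<gamma> x. \<gamma> \<in> \<Gamma> \<Longrightarrow> x \<in> split_line \<Gamma> \<Longrightarrow> \<theta> \<gamma> = f x - f (split_translate (- \<gamma>) x)"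
    and g: "\<gamma> \<in> \<Gamma>"
  shows "\<theta> \<gamma> = (0::int)"
proof -
  interpret irrational_rotation a b using ab(3,4) by unfold_locales
  have inv: "jump \<Gamma> f (t - \<gamma>) = jump \<Gamma> f t" if "\<gamma> \<in> \<Gamma>" for \<gamma> t
    using \<theta>[OF that, of "Upper t"] \<theta>[OF that, of "Lower t"] by (auto simp: jump_def diff_mem_iff that)
  have "jump \<Gamma> f t = 0" for t
    by (rule invariant_eq_0[OF locally_finite_jump[OF f]]) (rule inv; fact ab)+
  then have "f (Upper 0) = f (split_translate (- \<gamma>) (Upper 0))"
    by (rule constant_if_no_jumps[OF f]) (simp_all add: uminus_mem g)
  then show ?thesis using \<theta>[OF g, of "Upper 0"] by simp
qed

end

section \<open>Subgroups of the line of rank two\<close>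

lemma comm_group_real_add_group: "comm_group real_add_group"
proof (rule comm_groupI)
  fix x assume "x \<in> carrier real_add_group"
  show "\<exists>y\<in>carrier real_add_group. y \<otimes>\<^bsub>real_add_group\<^esub> x = \<one>\<^bsub>real_add_group\<^esub>"
    by (rule bexI[of _ "- x"]) (simp_all add: real_add_group_def)
qed (simp_all add: real_add_group_def)

lemma inv_real_add_group: "inv\<^bsub>real_add_group\<^esub> x = - x"
proof -
  interpret comm_group real_add_group by (rule comm_group_real_add_group)
  show ?thesis by (rule inv_equality) (simp_all add: real_add_group_def)
qed

lemma int_pow_real_add_group: "x [^]\<^bsub>real_add_group\<^esub> (n::int) = of_int n * x"
proof -
  interpret comm_group real_add_group by (rule comm_group_real_add_group)
  have nat: "x [^]\<^bsub>real_add_group\<^esub> (m::nat) = of_nat m * x" for m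
    by (induction m) (simp_all add: real_add_group_def nat_pow_def algebra_simps)
  show ?thesis
  proof (cases n rule: int_cases2)
    case (nonneg m)
    then show ?thesis by (simp add: int_pow_int nat)
  next
    case (nonpos m)
    then show ?thesis
      by (simp add: int_pow_neg int_pow_int nat inv_real_add_group real_add_group_def[THEN arg_cong[of _ _ carrier]])
  qed
qed

lemma real_subgroup_if_subgroup:
  assumes "subgroup \<Gamma> real_add_group"
  shows "real_subgroup \<Gamma>"
proof
  interpret subgroup \<Gamma> real_add_group by fact
  show "0 \<in> \<Gamma>" using one_closed by (simp add: real_add_group_def)
  fix x y assume xy: "x \<in> \<Gamma>" "y \<in> \<Gamma>"
  then have "- y \<in> \<Gamma>" using m_inv_closed[of y] by (simp add: inv_real_add_group)
  with xy(1) show "x - y \<in> \<Gamma>" using m_closed[of x "- y"] by (simp add: real_add_group_def)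
qed

text \<open>
  Density provides a positive \<open>b \<in> \<Gamma>\<close>. If no \<open>a \<in> \<Gamma>\<close> were incommensurable with it, the rank would be at most one.
\<close>
lemma exists_incommensurable:
  assumes sub: "subgroup \<Gamma> real_add_group" and dense: "closure \<Gamma> = UNIV"
    and rank: "group_rank (real_add_group\<lparr>carrier := \<Gamma>\<rparr>) = 2"
  obtains a b where "a \<in> \<Gamma>" "b \<in> \<Gamma>" "b > 0" "incommensurable a b"
proof -
  let ?G = "real_add_group\<lparr>carrier := \<Gamma>\<rparr>"
  interpret R: comm_group real_add_group by (rule comm_group_real_add_group)
  have "comm_group ?G"
    by (rule group.group_comm_groupI[OF R.subgroup_imp_group[OF sub]]) (simp add: real_add_group_def)
  then interpret G: comm_group ?G .
  have "closure \<Gamma> \<inter> {0<..} \<noteq> {}" using dense by (simp add: greaterThan_non_empty)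
  then have "\<Gamma> \<inter> {0<..} \<noteq> {}"
    using open_Int_closure_eq_empty[of "{0<..}" \<Gamma>] by (simp add: Int_commute)
  then obtain b where b: "b \<in> \<Gamma>" "b > 0" by auto
  have pow: "x [^]\<^bsub>?G\<^esub> (n::int) = of_int n * x" if "x \<in> \<Gamma>" for x n
    using R.int_pow_consistent[OF sub that, of n] by (simp add: int_pow_real_add_group)
  have "\<exists>a\<in>\<Gamma>. incommensurable a b"
  proof (rule ccontr)
    assume "\<not> ?thesis"
    then have dep: "\<exists>i m. of_int i * a + of_int m * b = 0 \<and> i \<noteq> 0" if "a \<in> \<Gamma>" for a
      using that unfolding incommensurable_def by blast
    have "vectorspace.dim rat_field (tensor_rat ?G) \<le> 1"
    proof (rule G.dim_tensor_rat_le_1)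
      show "b \<in> carrier ?G" using b by simp
      fix a assume a: "a \<in> carrier ?G"
      then obtain i m where im: "of_int i * a + of_int m * b = 0" "i \<noteq> 0" using dep[of a] by auto
      then have "a [^]\<^bsub>?G\<^esub> i = b [^]\<^bsub>?G\<^esub> (- m)" using a b by (simp add: pow)
      with im(2) show "\<exists>(m::int) n::int. m \<noteq> 0 \<and> a [^]\<^bsub>?G\<^esub> m = b [^]\<^bsub>?G\<^esub> n" by blast
    qed
    with rank show False
      by (auto simp: group_rank_def numeral_eq_enat split: if_splits)
  qed
  with b that show ?thesis by blast
qed

section \<open>The first cohomology of the transformation groupoid\<close>

lemma continuous_map_prod_discrete_iff:
  "continuous_map (prod_topology X (discrete_topology S)) (discrete_topology UNIV) f \<longleftrightarrow>
    (\<forall>s\<in>S. continuous_map X (discrete_topology UNIV) (\<lambda>x. f (x, s)))"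
proof (intro iffI ballI)
  fix s assume f: "continuous_map (prod_topology X (discrete_topology S)) (discrete_topology UNIV) f" and s: "s \<in> S"
  have "continuous_map X (prod_topology X (discrete_topology S)) (\<lambda>x. (x, s))"
    using s by (simp add: continuous_map_pairwise o_def)
  from continuous_map_compose[OF this f] show "continuous_map X (discrete_topology UNIV) (\<lambda>x. f (x, s))"
    by (simp add: o_def)
next
  assume f: "\<forall>s\<in>S. continuous_map X (discrete_topology UNIV) (\<lambda>x. f (x, s))"
  have "openin (prod_topology X (discrete_topology S)) {z \<in> topspace X \<times> S. f z \<in> U}" for U
  proof -
    have "{z \<in> topspace X \<times> S. f z \<in> U} = (\<Union>s\<in>S. {x \<in> topspace X. f (x, s) \<in> U} \<times> {s})" by auto
    moreover have "openin (prod_topology X (discrete_topology S)) ({x \<in> topspace X. f (x, s) \<in> U} \<times> {s})"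
      if "s \<in> S" for s
    proof -
      have "openin X {x \<in> topspace X. f (x, s) \<in> U}"
        using f that by (simp add: continuous_map_def)
      then show ?thesis using that by (simp add: openin_prod_Times_iff)
    qed
    ultimately show ?thesis by auto
  qed
  then show "continuous_map (prod_topology X (discrete_topology S)) (discrete_topology UNIV) f"
    by (simp add: continuous_map_def)
qed

context real_subgroup begin

abbreviation G where "G \<equiv> real_add_group\<lparr>carrier := \<Gamma>\<rparr>"
abbreviation H where "H \<equiv> transformation_groupoid (split_topology \<Gamma>) G split_translate"

lemma subgroup_real_add_group: "subgroup \<Gamma> real_add_group"
proof -
  interpret R: comm_group real_add_group by (rule comm_group_real_add_group)
  show ?thesis
    by (rule R.subgroupI) (auto simp: inv_real_add_group uminus_mem add_mem real_add_group_def[THEN arg_cong[of _ _ carrier]] real_add_group_def[THEN arg_cong[of _ _ mult]] intro: zero_mem)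
qed

lemma inv_G: "\<gamma> \<in> \<Gamma> \<Longrightarrow> inv\<^bsub>G\<^esub> \<gamma> = - \<gamma>"
proof -
  interpret R: comm_group real_add_group by (rule comm_group_real_add_group)
  show "\<gamma> \<in> \<Gamma> \<Longrightarrow> inv\<^bsub>G\<^esub> \<gamma> = - \<gamma>"
    using R.m_inv_consistent[OF subgroup_real_add_group] by (simp add: inv_real_add_group)
qed

lemma mult_real_add_group: "x \<otimes>\<^bsub>real_add_group\<^esub> y = x + y"
  by (simp add: real_add_group_def)

lemma groupoid_simps [simp]:
  "topspace (arrows H) = split_line \<Gamma> \<times> \<Gamma>"
  "units H = split_topology \<Gamma>"
  "grange H = fst"
  "gprod H (x, \<gamma>) (y, \<delta>) = (x, \<gamma> + \<delta>)"
  "\<gamma> \<in> \<Gamma> \<Longrightarrow> gsource H (x, \<gamma>) = split_translate (- \<gamma>) x"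
  by (simp_all add: transformation_groupoid_def inv_G mult_real_add_group)

text \<open>
  The composable pairs are those of \<open>(x, \<gamma>)\<close> with \<open>(x - \<gamma>, \<delta>)\<close>, and continuity on \<open>X \<times> \<Gamma>\<close> is continuity for each
  \<open>\<gamma>\<close> separately.
\<close>
lemma carrier_Z1: "\<xi> \<in> carrier (Z1 H) \<longleftrightarrow> \<xi> \<in> extensional (split_line \<Gamma> \<times> \<Gamma>) \<and>
    (\<forall>\<gamma>\<in>\<Gamma>. continuous_split \<Gamma> (\<lambda>x. \<xi> (x, \<gamma>))) \<and>
    (\<forall>\<gamma>\<in>\<Gamma>. \<forall>\<delta>\<in>\<Gamma>. \<forall>x\<in>split_line \<Gamma>. \<xi> (x, \<gamma> + \<delta>) = \<xi> (x, \<gamma>) + \<xi> (split_translate (- \<gamma>) x, \<delta>))"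
proof -
  have 1: "continuous_map (arrows H) (discrete_topology UNIV) \<xi> \<longleftrightarrow> (\<forall>\<gamma>\<in>\<Gamma>. continuous_split \<Gamma> (\<lambda>x. \<xi> (x, \<gamma>)))"
    by (simp add: transformation_groupoid_def continuous_map_prod_discrete_iff)
  have 2: "(\<forall>g\<in>topspace (arrows H). \<forall>h\<in>topspace (arrows H). gsource H g = grange H h \<longrightarrow> \<xi> (gprod H g h) = \<xi> g + \<xi> h)
    \<longleftrightarrow> (\<forall>\<gamma>\<in>\<Gamma>. \<forall>\<delta>\<in>\<Gamma>. \<forall>x\<in>split_line \<Gamma>. \<xi> (x, \<gamma> + \<delta>) = \<xi> (x, \<gamma>) + \<xi> (split_translate (- \<gamma>) x, \<delta>))"
    by (auto simp: split_translate_mem uminus_mem)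
  show ?thesis unfolding Z1_def using 1 2 by simp
qed

lemma mult_Z1: "\<xi> \<otimes>\<^bsub>Z1 H\<^esub> \<eta> = (\<lambda>g\<in>split_line \<Gamma> \<times> \<Gamma>. \<xi> g + \<eta> g)"
  by (simp add: Z1_def)

lemma one_Z1: "\<one>\<^bsub>Z1 H\<^esub> = (\<lambda>g\<in>split_line \<Gamma> \<times> \<Gamma>. 0)"
  by (simp add: Z1_def)

lemma continuous_split_cong:
  assumes "\<And>x. x \<in> split_line \<Gamma> \<Longrightarrow> f x = g x"
  shows "continuous_split \<Gamma> f \<longleftrightarrow> continuous_split \<Gamma> g"
proof
  assume "continuous_split \<Gamma> f"
  then show "continuous_split \<Gamma> g" by (rule continuous_map_eq) (simp add: assms)
next
  assume "continuous_split \<Gamma> g"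
  then show "continuous_split \<Gamma> f" by (rule continuous_map_eq) (simp add: assms)
qed

lemma restrict_mem_Z1:
  assumes "\<And>\<gamma>. \<gamma> \<in> \<Gamma> \<Longrightarrow> continuous_split \<Gamma> (\<lambda>x. f (x, \<gamma>))"
    and "\<And>\<gamma> \<delta> x. \<gamma> \<in> \<Gamma> \<Longrightarrow> \<delta> \<in> \<Gamma> \<Longrightarrow> x \<in> split_line \<Gamma> \<Longrightarrow>
      f (x, \<gamma> + \<delta>) = f (x, \<gamma>) + f (split_translate (- \<gamma>) x, \<delta>)"
  shows "restrict f (split_line \<Gamma> \<times> \<Gamma>) \<in> carrier (Z1 H)"
proof -
  have c: "continuous_split \<Gamma> (\<lambda>x. restrict f (split_line \<Gamma> \<times> \<Gamma>) (x, \<gamma>))" if "\<gamma> \<in> \<Gamma>" for \<gamma>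
    using assms(1)[OF that] by (subst continuous_split_cong[of _ "\<lambda>x. f (x, \<gamma>)"]) (simp_all add: that)
  show ?thesis
    unfolding carrier_Z1
    by (intro conjI ballI c restrict_extensional)
       (simp_all add: assms(2) add_mem split_translate_mem uminus_mem)
qed

lemma comm_group_Z1: "comm_group (Z1 H)"
proof (rule comm_groupI)
  fix \<xi> \<eta> assume \<xi>: "\<xi> \<in> carrier (Z1 H)" and \<eta>: "\<eta> \<in> carrier (Z1 H)"
  show "\<xi> \<otimes>\<^bsub>Z1 H\<^esub> \<eta> \<in> carrier (Z1 H)"
    unfolding mult_Z1
  proof (rule restrict_mem_Z1)
    show "continuous_split \<Gamma> (\<lambda>x. \<xi> (x, \<gamma>) + \<eta> (x, \<gamma>))" if "\<gamma> \<in> \<Gamma>" for \<gamma>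
      using \<xi> \<eta> that continuous_split_combine[of \<Gamma> "\<lambda>x. \<xi> (x, \<gamma>)" "\<lambda>x. \<eta> (x, \<gamma>)" "(+)"]
      by (simp add: carrier_Z1)
  qed (use \<xi> \<eta> in \<open>simp add: carrier_Z1\<close>)
  show "\<xi> \<otimes>\<^bsub>Z1 H\<^esub> \<eta> = \<eta> \<otimes>\<^bsub>Z1 H\<^esub> \<xi>"
    by (auto simp: mult_Z1)
next
  show "\<one>\<^bsub>Z1 H\<^esub> \<in> carrier (Z1 H)"
    unfolding one_Z1 by (rule restrict_mem_Z1) auto
next
  fix \<xi> assume \<xi>: "\<xi> \<in> carrier (Z1 H)"
  then have ext: "\<xi> \<in> extensional (split_line \<Gamma> \<times> \<Gamma>)" by (simp add: carrier_Z1)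
  show "\<one>\<^bsub>Z1 H\<^esub> \<otimes>\<^bsub>Z1 H\<^esub> \<xi> = \<xi>"
    by (rule extensionalityI[OF _ ext]) (auto simp: mult_Z1 one_Z1)
  show "\<exists>\<eta>\<in>carrier (Z1 H). \<eta> \<otimes>\<^bsub>Z1 H\<^esub> \<xi> = \<one>\<^bsub>Z1 H\<^esub>"
  proof (rule bexI[of _ "\<lambda>g\<in>split_line \<Gamma> \<times> \<Gamma>. - \<xi> g"])
    show "(\<lambda>g\<in>split_line \<Gamma> \<times> \<Gamma>. - \<xi> g) \<in> carrier (Z1 H)"
    proof (rule restrict_mem_Z1)
      show "continuous_split \<Gamma> (\<lambda>x. - \<xi> (x, \<gamma>))" if "\<gamma> \<in> \<Gamma>" for \<gamma>
        using \<xi> that continuous_split_combine[of \<Gamma> "\<lambda>x. \<xi> (x, \<gamma>)" "\<lambda>x. \<xi> (x, \<gamma>)" "\<lambda>u v. - u"]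
        by (simp add: carrier_Z1)
    qed (use \<xi> in \<open>simp add: carrier_Z1\<close>)
  qed (auto simp: mult_Z1 one_Z1)
next
  fix \<xi> \<eta> \<zeta>
  show "\<xi> \<otimes>\<^bsub>Z1 H\<^esub> \<eta> \<otimes>\<^bsub>Z1 H\<^esub> \<zeta> = \<xi> \<otimes>\<^bsub>Z1 H\<^esub> (\<eta> \<otimes>\<^bsub>Z1 H\<^esub> \<zeta>)"
    by (auto simp: mult_Z1)
qed

definition coboundary :: "(split_point \<Rightarrow> int) \<Rightarrow> split_point \<times> real \<Rightarrow> int" where
  "coboundary f = (\<lambda>(x, \<gamma>)\<in>split_line \<Gamma> \<times> \<Gamma>. f x - f (split_translate (- \<gamma>) x))"

lemma coboundary_apply:
  "x \<in> split_line \<Gamma> \<Longrightarrow> \<gamma> \<in> \<Gamma> \<Longrightarrow> coboundary f (x, \<gamma>) = f x - f (split_translate (- \<gamma>) x)"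
  by (simp add: coboundary_def)

lemma B1_eq: "B1 H = coboundary ` {f. continuous_split \<Gamma> f}"
proof -
  have "(\<lambda>g\<in>topspace (arrows H). f (grange H g) - f (gsource H g)) = coboundary f" for f
    unfolding coboundary_def by (auto simp: restrict_def fun_eq_iff)
  then show ?thesis unfolding B1_def by auto
qed

lemma subgroup_B1: "subgroup (B1 H) (Z1 H)"
proof (rule group.subgroupI)
  interpret Z: comm_group "Z1 H" by (rule comm_group_Z1)
  show "group (Z1 H)" ..
  show B1_sub: "B1 H \<subseteq> carrier (Z1 H)"
  proof
    fix \<beta> assume "\<beta> \<in> B1 H"
    then obtain f where f: "continuous_split \<Gamma> f" "\<beta> = coboundary f" by (auto simp: B1_eq)
    show "\<beta> \<in> carrier (Z1 H)"
      unfolding f(2) coboundary_def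
      by (rule restrict_mem_Z1) (use continuous_coboundary[OF f(1)] in simp_all)
  qed
  have "continuous_split \<Gamma> (\<lambda>_. 0)" by simp
  then show "B1 H \<noteq> {}" unfolding B1_eq by blast
  fix \<beta> assume "\<beta> \<in> B1 H"
  then obtain f where f: "continuous_split \<Gamma> f" "\<beta> = coboundary f" by (auto simp: B1_eq)
  have m: "continuous_split \<Gamma> (\<lambda>x. - f x)"
    using continuous_split_combine[OF f(1) f(1), of "\<lambda>u v. - u"] .
  then have "coboundary (\<lambda>x. - f x) \<in> B1 H" by (auto simp: B1_eq)
  moreover have "coboundary (\<lambda>x. - f x) \<otimes>\<^bsub>Z1 H\<^esub> \<beta> = \<one>\<^bsub>Z1 H\<^esub>"
    by (auto simp: mult_Z1 one_Z1 f(2) coboundary_def fun_eq_iff)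
  ultimately show "inv\<^bsub>Z1 H\<^esub> \<beta> \<in> B1 H"
    using Z.inv_equality[of "coboundary (\<lambda>x. - f x)" \<beta>] subsetD[OF B1_sub] \<open>\<beta> \<in> B1 H\<close> by metis
  fix \<beta>' assume "\<beta>' \<in> B1 H"
  then obtain f' where f': "continuous_split \<Gamma> f'" "\<beta>' = coboundary f'" by (auto simp: B1_eq)
  have "\<beta> \<otimes>\<^bsub>Z1 H\<^esub> \<beta>' = coboundary (\<lambda>x. f x + f' x)"
    by (auto simp: mult_Z1 f(2) f'(2) coboundary_def fun_eq_iff)
  then show "\<beta> \<otimes>\<^bsub>Z1 H\<^esub> \<beta>' \<in> B1 H"
    using continuous_split_combine[OF f(1) f'(1), of "(+)"] by (auto simp: B1_eq)
qed

lemma comm_group_H1: "comm_group (H1 H)"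
  unfolding H1_def by (rule comm_group.abelian_FactGroup[OF comm_group_Z1 subgroup_B1])

lemma carrier_Hom_int: "\<phi> \<in> carrier (Hom_int G) \<longleftrightarrow>
    \<phi> \<in> extensional \<Gamma> \<and> (\<forall>\<gamma>\<in>\<Gamma>. \<forall>\<delta>\<in>\<Gamma>. \<phi> (\<gamma> + \<delta>) = \<phi> \<gamma> + \<phi> \<delta>)"
  by (auto simp: Hom_int_def hom_def mult_real_add_group integer_group_def)

lemma group_Hom_int: "group (Hom_int G)"
proof (rule groupI)
  fix \<phi> assume \<phi>: "\<phi> \<in> carrier (Hom_int G)"
  then have ext: "\<phi> \<in> extensional \<Gamma>" by (simp add: carrier_Hom_int)
  show "\<one>\<^bsub>Hom_int G\<^esub> \<otimes>\<^bsub>Hom_int G\<^esub> \<phi> = \<phi>"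
    by (rule extensionalityI[OF _ ext]) (auto simp: Hom_int_def)
  show "\<exists>\<psi>\<in>carrier (Hom_int G). \<psi> \<otimes>\<^bsub>Hom_int G\<^esub> \<phi> = \<one>\<^bsub>Hom_int G\<^esub>"
    using \<phi> by (intro bexI[of _ "\<lambda>\<gamma>\<in>\<Gamma>. - \<phi> \<gamma>"]) (auto simp: carrier_Hom_int add_mem, auto simp: Hom_int_def)
next
  fix \<phi> \<psi> \<theta> assume \<phi>: "\<phi> \<in> carrier (Hom_int G)" and \<psi>: "\<psi> \<in> carrier (Hom_int G)"
  have "\<phi> \<otimes>\<^bsub>Hom_int G\<^esub> \<psi> = (\<lambda>\<gamma>\<in>\<Gamma>. \<phi> \<gamma> + \<psi> \<gamma>)" by (simp add: Hom_int_def)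
  with \<phi> \<psi> show "\<phi> \<otimes>\<^bsub>Hom_int G\<^esub> \<psi> \<in> carrier (Hom_int G)" by (simp add: carrier_Hom_int add_mem)
  show "\<phi> \<otimes>\<^bsub>Hom_int G\<^esub> \<psi> \<otimes>\<^bsub>Hom_int G\<^esub> \<theta> = \<phi> \<otimes>\<^bsub>Hom_int G\<^esub> (\<psi> \<otimes>\<^bsub>Hom_int G\<^esub> \<theta>)"
    by (auto simp: Hom_int_def)
next
  have "\<one>\<^bsub>Hom_int G\<^esub> = (\<lambda>\<gamma>\<in>\<Gamma>. 0)" by (simp add: Hom_int_def)
  then show "\<one>\<^bsub>Hom_int G\<^esub> \<in> carrier (Hom_int G)" by (simp add: carrier_Hom_int add_mem)
qed

lemma Z1_group_groupoid: "Z1 (group_groupoid G) = Hom_int G"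
  by (auto simp: Z1_def Hom_int_def group_groupoid_def hom_def integer_group_def)

lemma B1_group_groupoid: "B1 (group_groupoid G) = {\<one>\<^bsub>Hom_int G\<^esub>}"
  by (auto simp: B1_def Hom_int_def group_groupoid_def)

definition pullback :: "(real \<Rightarrow> int) \<Rightarrow> split_point \<times> real \<Rightarrow> int" where
  "pullback \<phi> = restrict (\<phi> \<circ> snd) (split_line \<Gamma> \<times> \<Gamma>)"

lemma pullback_mem_Z1: "\<phi> \<in> carrier (Hom_int G) \<Longrightarrow> pullback \<phi> \<in> carrier (Z1 H)"
  unfolding pullback_def by (rule restrict_mem_Z1) (auto simp: carrier_Hom_int)

lemma pullback_class_eq: "pullback_class H snd = (\<lambda>\<xi>. B1 H #>\<^bsub>Z1 H\<^esub> \<xi>) \<circ> pullback"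
  by (simp add: fun_eq_iff pullback_class_def pullback_def)

lemma pullback_class_hom: "pullback_class H snd \<in> hom (Hom_int G) (H1 H)"
proof -
  interpret Z: comm_group "Z1 H" by (rule comm_group_Z1)
  interpret N: normal "B1 H" "Z1 H" by (rule Z.subgroup_imp_normal[OF subgroup_B1])
  have "pullback \<in> hom (Hom_int G) (Z1 H)"
  proof (rule homI)
    show "pullback (\<phi> \<otimes>\<^bsub>Hom_int G\<^esub> \<psi>) = pullback \<phi> \<otimes>\<^bsub>Z1 H\<^esub> pullback \<psi>" for \<phi> \<psi>
      by (auto simp: pullback_def mult_Z1 Hom_int_def fun_eq_iff)
  qed (rule pullback_mem_Z1)
  then show ?thesis
    unfolding pullback_class_eq H1_def by (rule hom_compose) (rule N.r_coset_hom_Mod)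
qed

text \<open>
  Injectivity is the vanishing of homomorphisms that are coboundaries; surjectivity is the fact that every
  cocycle is cohomologous to a family of constants, which the cocycle identity at one point shows to be a
  homomorphism.
\<close>
lemma pullback_class_iso:
  assumes ab: "a \<in> \<Gamma>" "b \<in> \<Gamma>" "b > 0" "incommensurable a b"
  shows "pullback_class H snd \<in> iso (Hom_int G) (H1 H)"
proof -
  interpret Z: comm_group "Z1 H" by (rule comm_group_Z1)
  have "inj_on (pullback_class H snd) (carrier (Hom_int G))"
  proof (rule inj_onI)
    fix \<phi> \<psi> assume \<phi>: "\<phi> \<in> carrier (Hom_int G)" and \<psi>: "\<psi> \<in> carrier (Hom_int G)"
      and eq: "pullback_class H snd \<phi> = pullback_class H snd \<psi>"
    have "pullback \<phi> \<in> B1 H #>\<^bsub>Z1 H\<^esub> pullback \<psi>"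
      using eq Z.rcos_self[OF pullback_mem_Z1[OF \<phi>] subgroup_B1] by (simp add: pullback_class_eq)
    then obtain f where f: "continuous_split \<Gamma> f" "pullback \<phi> = coboundary f \<otimes>\<^bsub>Z1 H\<^esub> pullback \<psi>"
      by (auto simp: r_coset_def B1_eq)
    have "\<phi> \<gamma> - \<psi> \<gamma> = f x - f (split_translate (- \<gamma>) x)" if "\<gamma> \<in> \<Gamma>" "x \<in> split_line \<Gamma>" for \<gamma> x
      using fun_cong[OF f(2), of "(x, \<gamma>)"] that by (simp add: mult_Z1 pullback_def coboundary_apply)
    from constant_coboundary_eq_0[OF ab f(1), of "\<lambda>\<gamma>. \<phi> \<gamma> - \<psi> \<gamma>", OF this]
    have "\<phi> \<gamma> = \<psi> \<gamma>" if "\<gamma> \<in> \<Gamma>" for \<gamma> using that by simp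
    then show "\<phi> = \<psi>" using \<phi> \<psi> by (intro extensionalityI[of _ \<Gamma>]) (simp_all add: carrier_Hom_int)
  qed
  moreover have "carrier (H1 H) \<subseteq> pullback_class H snd ` carrier (Hom_int G)"
  proof
    fix C assume "C \<in> carrier (H1 H)"
    then obtain \<xi> where \<xi>: "\<xi> \<in> carrier (Z1 H)" "C = B1 H #>\<^bsub>Z1 H\<^esub> \<xi>"
      by (auto simp: H1_def carrier_FactGroup)
    have "\<exists>h \<phi>. continuous_split \<Gamma> h \<and>
      (\<forall>\<gamma>\<in>\<Gamma>. \<forall>x\<in>split_line \<Gamma>. \<xi> (x, \<gamma>) = \<phi> \<gamma> + (h x - h (split_translate (- \<gamma>) x)))"
      by (rule cocycle_cohomologous_to_hom[OF ab]) (use \<xi>(1) in \<open>simp_all add: carrier_Z1\<close>)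
    then obtain h \<phi> where h: "continuous_split \<Gamma> h" and
      eq: "\<And>\<gamma> x. \<gamma> \<in> \<Gamma> \<Longrightarrow> x \<in> split_line \<Gamma> \<Longrightarrow> \<xi> (x, \<gamma>) = \<phi> \<gamma> + (h x - h (split_translate (- \<gamma>) x))"
      by blast
    define \<psi> where "\<psi> = restrict \<phi> \<Gamma>"
    have \<psi>: "\<psi> \<in> carrier (Hom_int G)"
      unfolding carrier_Hom_int
    proof (intro conjI ballI)
      fix \<gamma> \<delta> assume g: "\<gamma> \<in> \<Gamma>" "\<delta> \<in> \<Gamma>"
      have "\<xi> (Upper 0, \<gamma> + \<delta>) = \<xi> (Upper 0, \<gamma>) + \<xi> (split_translate (- \<gamma>) (Upper 0), \<delta>)"
        using \<xi>(1) g by (simp add: carrier_Z1)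
      then show "\<psi> (\<gamma> + \<delta>) = \<psi> \<gamma> + \<psi> \<delta>"
        using g by (simp add: eq add_mem uminus_mem \<psi>_def)
    qed (simp add: \<psi>_def)
    have "\<xi> = coboundary h \<otimes>\<^bsub>Z1 H\<^esub> pullback \<psi>"
      by (rule extensionalityI[of _ "split_line \<Gamma> \<times> \<Gamma>"])
         (use \<xi>(1) in \<open>auto simp: mult_Z1 carrier_Z1 eq coboundary_apply pullback_def \<psi>_def\<close>)
    moreover have "coboundary h \<in> B1 H" using h by (simp add: B1_eq)
    ultimately have "\<xi> \<in> B1 H #>\<^bsub>Z1 H\<^esub> pullback \<psi>" by (auto simp: r_coset_def)
    then have "B1 H #>\<^bsub>Z1 H\<^esub> pullback \<psi> = C"
      unfolding \<xi>(2) by (rule Z.repr_independence[OF _ pullback_mem_Z1[OF \<psi>] subgroup_B1])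
    with \<psi> show "C \<in> pullback_class H snd ` carrier (Hom_int G)"
      by (auto simp: pullback_class_eq)
  qed
  moreover have "pullback_class H snd ` carrier (Hom_int G) \<subseteq> carrier (H1 H)"
    using pullback_class_hom by (auto simp: hom_def)
  ultimately show ?thesis
    using pullback_class_hom by (simp add: iso_def bij_betw_def subset_antisym)
qed

text \<open>
  Coboundaries of a group acting trivially on a point vanish, so the first cohomology of \<open>\<Gamma>\<close> is
  \<open>Hom(\<Gamma>, \<int>)\<close> modulo the trivial subgroup, which is the kernel of the isomorphism.
\<close>
lemma H1_rigid_if_pullback_class_iso:
  assumes iso: "pullback_class H snd \<in> iso (Hom_int G) (H1 H)"
  shows "H1_rigid (split_topology \<Gamma>) G split_translate"
proof -
  interpret P: group_hom "Hom_int G" "H1 H" "pullback_class H snd"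
    using pullback_class_hom group_Hom_int comm_group.axioms(2)[OF comm_group_H1]
    by (simp add: group_hom_def group_hom_axioms_def)
  have "kernel (Hom_int G) (H1 H) (pullback_class H snd) = {\<one>\<^bsub>Hom_int G\<^esub>}"
    using iso P.inj_iff_trivial_ker by (simp add: iso_def bij_betw_def)
  then have gg: "H1 (group_groupoid G) = Hom_int G Mod kernel (Hom_int G) (H1 H) (pullback_class H snd)"
    by (simp add: H1_def Z1_group_groupoid B1_group_groupoid)
  have "H1_map H snd = (\<lambda>C. the_elem (pullback_class H snd ` C))"
    by (simp add: fun_eq_iff H1_map_def)
  moreover have "pullback_class H snd ` carrier (Hom_int G) = carrier (H1 H)"
    using iso by (simp add: iso_def bij_betw_def)
  ultimately show ?thesis
    unfolding H1_rigid_def gg using P.FactGroup_iso_set by simp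
qed

end

theorem lemma4p4:
  fixes \<Gamma> :: "real set"
  defines "G \<equiv> real_add_group\<lparr>carrier := \<Gamma>\<rparr>"
  defines "\<H> \<equiv> transformation_groupoid (split_topology \<Gamma>) G split_translate"
  assumes "subgroup \<Gamma> real_add_group"
    and "countable \<Gamma>"
    and "closure \<Gamma> = UNIV"
    and "group_rank G = 2"
  shows "H1_rigid (split_topology \<Gamma>) G split_translate \<and>
         pullback_class \<H> snd \<in> iso (Hom_int G) (H1 \<H>)"
proof -
  interpret real_subgroup \<Gamma> by (rule real_subgroup_if_subgroup) fact
  obtain a b where "a \<in> \<Gamma>" "b \<in> \<Gamma>" "b > 0" "incommensurable a b"
    using exists_incommensurable assms(3,5,6) unfolding G_def by blast
  from pullback_class_iso[OF this] H1_rigid_if_pullback_class_iso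
  show ?thesis unfolding G_def \<H>_def by blast
qed

end
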